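(* Let $s \ge 3$ and $k \ge s+4$ be integers, let $a \in \mathbb N$ with $a \le 2^{k-s-2} + 2^{k-s-3} + 1$, and let $\alpha = s - 1 - \frac{1}{2^{k-s+1} + a}$. Then the random hypergraph $G^s(n, n^{-\alpha})$ does not obey the zero-one $k$-law.
   Context: For integers $s \ge 2$, $n \ge 1$ and $p\in[0,1]$, the random $s$-uniform hypergraph $G^s(n,p)$ is the random $s$-uniform hypergraph on vertex set $\{1,\dots,n\}$ in which each of the $\binom{n}{s}$ possible $s$-element edges is present independently with probability $p$. First-order properties of $s$-uniform hypergraphs are those expressible by first-order formulae built from the $s$-ary predicate symbol $N$ (meaning "these $s$ vertices form an edge"), equality, logical connectives, variables and quantifiers $\forall,\exists$ over vertices. The quantifier depth of a formula is the maximum number of nested quantifiers. $G^s(n,p(n))$ obeys the zero-one $k$-law if for every first-order property $L$ expressible by a formula of quantifier depth at most $k$, the probability $\Pr[G^s(n,p(n)) \models L]$ tends either to $0$ or to $1$ as $n\to\infty$. $\mathbb N=\{1,2,\dots\}$. *)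

theory Defs
  imports "HOL-Probability.Probability"
begin

text \<open>
  First-order formulae over one relation symbol \<open>N\<close> and equality, with variables named by
  natural numbers. The arity of \<open>N\<close> is not part of the type; it is imposed by \<open>of_arity\<close>.
\<close>

datatype fo_formula =
    N "nat list"
  | Eq nat nat
  | Neg fo_formula
  | Conj fo_formula fo_formula
  | Disj fo_formula fo_formula
  | Imp fo_formula fo_formula
  | Iff fo_formula fo_formula
  | All nat fo_formula
  | Ex nat fo_formula

primrec of_arity :: "nat \<Rightarrow> fo_formula \<Rightarrow> bool" where
  "of_arity s (N xs) \<longleftrightarrow> length xs = s"
| "of_arity s (Eq x y) \<longleftrightarrow> True"
| "of_arity s (Neg \<phi>) \<longleftrightarrow> of_arity s \<phi>"
| "of_arity s (Conj \<phi> \<psi>) \<longleftrightarrow> of_arity s \<phi> \<and> of_arity s \<psi>"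
| "of_arity s (Disj \<phi> \<psi>) \<longleftrightarrow> of_arity s \<phi> \<and> of_arity s \<psi>"
| "of_arity s (Imp \<phi> \<psi>) \<longleftrightarrow> of_arity s \<phi> \<and> of_arity s \<psi>"
| "of_arity s (Iff \<phi> \<psi>) \<longleftrightarrow> of_arity s \<phi> \<and> of_arity s \<psi>"
| "of_arity s (All x \<phi>) \<longleftrightarrow> of_arity s \<phi>"
| "of_arity s (Ex x \<phi>) \<longleftrightarrow> of_arity s \<phi>"

primrec free_vars :: "fo_formula \<Rightarrow> nat set" where
  "free_vars (N xs) = set xs"
| "free_vars (Eq x y) = {x, y}"
| "free_vars (Neg \<phi>) = free_vars \<phi>"
| "free_vars (Conj \<phi> \<psi>) = free_vars \<phi> \<union> free_vars \<psi>"
| "free_vars (Disj \<phi> \<psi>) = free_vars \<phi> \<union> free_vars \<psi>"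
| "free_vars (Imp \<phi> \<psi>) = free_vars \<phi> \<union> free_vars \<psi>"
| "free_vars (Iff \<phi> \<psi>) = free_vars \<phi> \<union> free_vars \<psi>"
| "free_vars (All x \<phi>) = free_vars \<phi> - {x}"
| "free_vars (Ex x \<phi>) = free_vars \<phi> - {x}"

primrec quantifier_depth :: "fo_formula \<Rightarrow> nat" where
  "quantifier_depth (N xs) = 0"
| "quantifier_depth (Eq x y) = 0"
| "quantifier_depth (Neg \<phi>) = quantifier_depth \<phi>"
| "quantifier_depth (Conj \<phi> \<psi>) = max (quantifier_depth \<phi>) (quantifier_depth \<psi>)"
| "quantifier_depth (Disj \<phi> \<psi>) = max (quantifier_depth \<phi>) (quantifier_depth \<psi>)"
| "quantifier_depth (Imp \<phi> \<psi>) = max (quantifier_depth \<phi>) (quantifier_depth \<psi>)"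
| "quantifier_depth (Iff \<phi> \<psi>) = max (quantifier_depth \<phi>) (quantifier_depth \<psi>)"
| "quantifier_depth (All x \<phi>) = Suc (quantifier_depth \<phi>)"
| "quantifier_depth (Ex x \<phi>) = Suc (quantifier_depth \<phi>)"

text \<open>
  A hypergraph is a vertex set \<open>V\<close> with a set \<open>E\<close> of edges, each edge being a set of vertices.
  In an \<open>s\<close>-uniform hypergraph an \<open>s\<close>-ary atom with two equal values is false, since its set of
  values has fewer than \<open>s\<close> elements.
\<close>

primrec satisfies :: "'v set \<Rightarrow> 'v set set \<Rightarrow> (nat \<Rightarrow> 'v) \<Rightarrow> fo_formula \<Rightarrow> bool" where
  "satisfies V E \<sigma> (N xs) \<longleftrightarrow> \<sigma> ` set xs \<in> E"
| "satisfies V E \<sigma> (Eq x y) \<longleftrightarrow> \<sigma> x = \<sigma> y"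
| "satisfies V E \<sigma> (Neg \<phi>) \<longleftrightarrow> \<not> satisfies V E \<sigma> \<phi>"
| "satisfies V E \<sigma> (Conj \<phi> \<psi>) \<longleftrightarrow> satisfies V E \<sigma> \<phi> \<and> satisfies V E \<sigma> \<psi>"
| "satisfies V E \<sigma> (Disj \<phi> \<psi>) \<longleftrightarrow> satisfies V E \<sigma> \<phi> \<or> satisfies V E \<sigma> \<psi>"
| "satisfies V E \<sigma> (Imp \<phi> \<psi>) \<longleftrightarrow> (satisfies V E \<sigma> \<phi> \<longrightarrow> satisfies V E \<sigma> \<psi>)"
| "satisfies V E \<sigma> (Iff \<phi> \<psi>) \<longleftrightarrow> (satisfies V E \<sigma> \<phi> \<longleftrightarrow> satisfies V E \<sigma> \<psi>)"
| "satisfies V E \<sigma> (All x \<phi>) \<longleftrightarrow> (\<forall>u\<in>V. satisfies V E (\<sigma>(x := u)) \<phi>)"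
| "satisfies V E \<sigma> (Ex x \<phi>) \<longleftrightarrow> (\<exists>u\<in>V. satisfies V E (\<sigma>(x := u)) \<phi>)"

lemma satisfies_cong_free_vars:
  assumes "\<And>x. x \<in> free_vars \<phi> \<Longrightarrow> \<sigma> x = \<tau> x"
  shows "satisfies V E \<sigma> \<phi> \<longleftrightarrow> satisfies V E \<tau> \<phi>"
  using assms
proof (induction \<phi> arbitrary: \<sigma> \<tau>)
  case (N xs)
  then have "\<sigma> ` set xs = \<tau> ` set xs"
    by (intro image_cong) auto
  then show ?case by simp
next
  case (Conj \<phi> \<psi>)
  then show ?case by (metis UnCI free_vars.simps(4) satisfies.simps(4))
next
  case (Disj \<phi> \<psi>)
  then show ?case by (metis UnCI free_vars.simps(5) satisfies.simps(5))
next
  case (Imp \<phi> \<psi>)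
  then show ?case by (metis UnCI free_vars.simps(6) satisfies.simps(6))
next
  case (Iff \<phi> \<psi>)
  then show ?case by (metis UnCI free_vars.simps(7) satisfies.simps(7))
next
  case (Neg \<phi>)
  then show ?case by (metis free_vars.simps(3) satisfies.simps(3))
next
  case (All x \<phi>)
  have "satisfies V E (\<sigma>(x := u)) \<phi> = satisfies V E (\<tau>(x := u)) \<phi>" for u
    by (rule All.IH) (use All.prems in auto)
  then show ?case by simp
next
  case (Ex x \<phi>)
  have "satisfies V E (\<sigma>(x := u)) \<phi> = satisfies V E (\<tau>(x := u)) \<phi>" for u
    by (rule Ex.IH) (use Ex.prems in auto)
  then show ?case by simp
qed simp

text \<open>For sentences the choice of the assignment is irrelevant, by the lemma above.\<close>

definition models :: "'v set \<Rightarrow> 'v set set \<Rightarrow> fo_formula \<Rightarrow> bool" where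
  "models V E \<phi> \<longleftrightarrow> (\<forall>\<sigma>. range \<sigma> \<subseteq> V \<longrightarrow> satisfies V E \<sigma> \<phi>)"

definition possible_edges :: "nat \<Rightarrow> nat \<Rightarrow> nat set set" where
  "possible_edges s n = {e. e \<subseteq> {1..n} \<and> card e = s}"

definition random_hypergraph :: "nat \<Rightarrow> nat \<Rightarrow> real \<Rightarrow> nat set set pmf" where
  "random_hypergraph s n p =
     map_pmf (\<lambda>present. {e \<in> possible_edges s n. present e})
       (Pi_pmf (possible_edges s n) False (\<lambda>_. bernoulli_pmf p))"

definition obeys_zero_one_law :: "nat \<Rightarrow> (nat \<Rightarrow> real) \<Rightarrow> nat \<Rightarrow> bool" where
  "obeys_zero_one_law s p k \<longleftrightarrow>
     (\<forall>\<phi>. of_arity s \<phi> \<and> free_vars \<phi> = {} \<and> quantifier_depth \<phi> \<le> k \<longrightarrow>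
        (let prob = (\<lambda>n. measure_pmf.prob (random_hypergraph s n (p n)) {E. models {1..n} E \<phi>})
         in prob \<longlonglongrightarrow> 0 \<or> prob \<longlonglongrightarrow> 1))"

end

theory Submission
  imports Defs
begin

text \<open>
  Write \<open>m = 2 ^ (k - s + 1) + a\<close> and call \<open>(s - 1) |F| - |\<Union>F|\<close> the excess of an edge set
  \<open>F\<close>. At \<open>p = n powr - \<alpha>\<close> the expected number of edge sets with \<open>f\<close> edges and excess \<open>j\<close>
  is of order \<open>n powr (f / m - j)\<close>. Hence edge sets with at most \<open>m\<close> edges and positive
  excess have bounded expected number, and by Harris' inequality they are all absent with probability
  bounded away from 0. A fixed hypergraph with \<open>m\<close> edges and excess 1, all of whose proper
  nonempty edge subsets have excess at most 0, appears with probability bounded away from 0 by the second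
  moment method.

  It remains to find a formula of quantifier depth \<open>k\<close> that holds whenever a particular such
  hypergraph is present and fails unless some set of at most \<open>m\<close> edges with positive excess is.
  The hypergraph is a dumbbell: two edges sharing two vertices, joined by a path of
  \<open>2 * (2 ^ (k - s) - 2)\<close> edges to a cycle of length \<open>a + 2\<close>. The formula names the midpoint
  of the path; walks of length up to \<open>2 ^ t\<close> are expressed by repeated halving with depth
  \<open>t + s - 2\<close>. The cycle is expressed by two adjacent vertices \<open>x, z\<close> joined by a walk none of whose
  edges contains both; this distinguishes it from the pair of edges sharing two vertices.
\<close>

section \<open>Excess of edge sets\<close>

text \<open>A connected edge set in which every new edge meets the earlier ones in exactly one
  vertex has excess -1. Every further coincidence of vertices adds 1, so excess 1 means two
  independent coincidences.\<close>

definition excess :: "nat \<Rightarrow> 'a set set \<Rightarrow> int" where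
  "excess s F = (int s - 1) * int (card F) - int (card (\<Union>F))"

definition uniform :: "nat \<Rightarrow> 'a set set \<Rightarrow> bool" where
  "uniform s F \<longleftrightarrow> finite F \<and> (\<forall>e\<in>F. finite e \<and> card e = s)"

lemma uniform_finite: "uniform s F \<Longrightarrow> finite F"
  and uniform_finite_Union: "uniform s F \<Longrightarrow> finite (\<Union>F)"
  and uniform_subset: "uniform s F \<Longrightarrow> F' \<subseteq> F \<Longrightarrow> uniform s F'"
  and uniform_insert: "uniform s (insert e F) \<longleftrightarrow> finite e \<and> card e = s \<and> uniform s F"
  unfolding uniform_def by (auto intro: finite_subset)

lemma excess_insert:
  assumes "uniform s (insert e F)" and "e \<notin> F"
  shows "excess s (insert e F) = excess s F + int (card (e \<inter> \<Union>F)) - 1"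
proof -
  have u: "finite e" "card e = s" "uniform s F" using assms by (auto simp: uniform_insert)
  have "card e + card (\<Union>F) = card (e \<union> \<Union>F) + card (e \<inter> \<Union>F)"
    using u by (intro card_Un_Int uniform_finite_Union)
  then have "int (card (e \<union> \<Union>F)) = int s + int (card (\<Union>F)) - int (card (e \<inter> \<Union>F))"
    using u(2) by linarith
  then show ?thesis
    using u assms(2) by (simp add: excess_def uniform_finite algebra_simps)
qed

lemma excess_insert_ge:
  assumes "uniform s (insert e F)" and "e \<notin> F" and "X \<subseteq> e \<inter> \<Union>F" and "card X \<ge> i"
  shows "excess s (insert e F) \<ge> excess s F + int i - 1"
proof -
  have "card X \<le> card (e \<inter> \<Union>F)"
    using assms by (intro card_mono) (auto simp: uniform_insert)
  then show ?thesis using excess_insert[OF assms(1,2)] assms(4) by linarith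
qed

text \<open>Edge counts are modular. Every vertex of a common edge lies in both spans, so vertex
  counts are submodular and the excess is supermodular.\<close>

lemma excess_Un_ge:
  assumes "uniform s F" and "uniform s F'"
  shows "excess s (F \<union> F') \<ge> excess s F + excess s F' - excess s (F \<inter> F')"
proof -
  have f: "finite F" "finite F'" "finite (\<Union>F)" "finite (\<Union>F')"
    using assms by (auto intro: uniform_finite uniform_finite_Union simp del: finite_Union)
  have 1: "card F + card F' = card (F \<union> F') + card (F \<inter> F')"
    using f by (intro card_Un_Int)
  have 2: "card (\<Union>F) + card (\<Union>F') = card (\<Union>(F \<union> F')) + card (\<Union>F \<inter> \<Union>F')"
    using card_Un_Int[OF f(3,4)] by (simp only: Union_Un_distrib)
  have "card (\<Union>(F \<inter> F')) \<le> card (\<Union>F \<inter> \<Union>F')"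
    using f by (intro card_mono) auto
  then have "int (card (\<Union>(F \<union> F'))) \<le> card (\<Union>F) + card (\<Union>F') - int (card (\<Union>(F \<inter> F')))"
    using 2 by linarith
  moreover have "(int s - 1) * card F + (int s - 1) * card F'
    = (int s - 1) * card (F \<union> F') + (int s - 1) * card (F \<inter> F')"
    using 1 by (metis distrib_left of_nat_add)
  ultimately show ?thesis unfolding excess_def by linarith
qed

lemma excess_disjoint_Un:
  assumes "uniform s F" and "uniform s F'" and "F \<inter> F' = {}"
  shows "excess s (F \<union> F') = excess s F + excess s F' + int (card (\<Union>F \<inter> \<Union>F'))"
proof -
  have f: "finite F" "finite F'" "finite (\<Union>F)" "finite (\<Union>F')"
    using assms by (auto intro: uniform_finite uniform_finite_Union simp del: finite_Union)
  have 1: "card (F \<union> F') = card F + card F'"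
    using f assms(3) by (intro card_Un_disjoint)
  have 2: "card (\<Union>F) + card (\<Union>F') = card (\<Union>(F \<union> F')) + card (\<Union>F \<inter> \<Union>F')"
    using card_Un_Int[OF f(3,4)] by (simp only: Union_Un_distrib)
  then have "int (card (\<Union>(F \<union> F'))) = card (\<Union>F) + card (\<Union>F') - int (card (\<Union>F \<inter> \<Union>F'))"
    by linarith
  then show ?thesis unfolding excess_def 1 by (simp add: algebra_simps)
qed

lemma excess_image:
  assumes "inj_on g (\<Union>F)"
  shows "excess s ((\<lambda>e. g ` e) ` F) = excess s F"
proof -
  have "\<Union>((\<lambda>e. g ` e) ` F) = g ` \<Union>F" by auto
  then show ?thesis
    unfolding excess_def using assms by (simp add: card_image inj_on_image)
qed

section \<open>Walks and connected edge sets\<close>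

text \<open>\<open>A\<close> is a pair of vertices that no edge used may contain together.
  \<open>A = {}\<close> is singled out to mean no restriction, since \<open>{} \<subseteq> e\<close>
  would otherwise exclude every edge.\<close>

definition adj :: "'v set set \<Rightarrow> 'v set \<Rightarrow> ('v \<times> 'v) set" where
  "adj E A = {(u, v). u \<noteq> v \<and> (\<exists>e\<in>E. u \<in> e \<and> v \<in> e \<and> (A = {} \<or> \<not> A \<subseteq> e))}"

inductive connected_edges :: "'v set set \<Rightarrow> bool" where
  single: "connected_edges {e}"
| insert: "connected_edges P \<Longrightarrow> e \<inter> \<Union>P \<noteq> {} \<Longrightarrow> e \<notin> P \<Longrightarrow> connected_edges (insert e P)"

text \<open>The first edge has excess -1. Each later edge meets the earlier span in at least one
  vertex, so the excess never drops; it rises as soon as an edge shares two vertices with an earlier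
  one.\<close>

lemma connected_edges_excess:
  assumes "connected_edges P" and "uniform s P"
  shows "excess s P \<ge> -1 \<and>
    (\<forall>e\<in>P. \<forall>f\<in>P. e \<noteq> f \<and> card (e \<inter> f) \<ge> 2 \<longrightarrow> excess s P \<ge> 0)"
  using assms
proof induction
  case (single e)
  then show ?case by (simp add: excess_def uniform_def)
next
  case (insert P e)
  then have u: "uniform s P" "finite e" by (auto simp: uniform_insert)
  note IH = insert.IH[OF u(1)]
  have "card (e \<inter> \<Union>P) \<ge> 1" using insert.hyps(2) u(2) by (simp add: Suc_leI card_gt_0_iff)
  then have ge: "excess s (insert e P) \<ge> excess s P"
    using excess_insert_ge[OF insert.prems insert.hyps(3) subset_refl] by fastforce
  have new: "excess s (insert e P) \<ge> 0" if "f \<in> P" "card (e \<inter> f) \<ge> 2" for f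
    using excess_insert_ge[OF insert.prems insert.hyps(3), of "e \<inter> f" 2] that IH by force
  show ?case
  proof (intro conjI ballI impI)
    show "- 1 \<le> excess s (insert e P)" using ge IH by linarith
    fix g f assume "g \<in> insert e P" "f \<in> insert e P" "g \<noteq> f \<and> 2 \<le> card (g \<inter> f)"
    then consider "g \<in> P" "f \<in> P" "g \<noteq> f" "2 \<le> card (g \<inter> f)" | "f \<in> P" "2 \<le> card (e \<inter> f)"
      | "g \<in> P" "2 \<le> card (e \<inter> g)"
      by (auto simp: Int_commute)
    then show "0 \<le> excess s (insert e P)"
      using new ge IH by cases force+
  qed
qed

lemma walk_connected_edges:
  assumes "(u, v) \<in> adj E A ^^ l" and "u \<noteq> v"
  obtains P where "connected_edges P" "P \<subseteq> E" "A \<noteq> {} \<Longrightarrow> \<forall>e\<in>P. \<not> A \<subseteq> e" "finite P"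
    "card P \<le> l" "u \<in> \<Union>P" "v \<in> \<Union>P"
proof -
  \<comment> \<open>The empty walk uses no edge and \<open>connected_edges\<close> never holds of
    the empty set, hence the first disjunct. A repeated edge is absorbed, so \<open>card P\<close>
    may be less than \<open>l\<close>.\<close>
  have "l = 0 \<and> u = v \<or> (\<exists>P. connected_edges P \<and> P \<subseteq> E \<and> (A \<noteq> {} \<longrightarrow> (\<forall>e\<in>P. \<not> A \<subseteq> e)) \<and> finite P
    \<and> card P \<le> l \<and> u \<in> \<Union>P \<and> v \<in> \<Union>P)"
    using assms(1)
  proof (induction l arbitrary: v)
    case (Suc l)
    then obtain w e where w: "(u, w) \<in> adj E A ^^ l" and e: "e \<in> E" "w \<in> e" "v \<in> e" "A = {} \<or> \<not> A \<subseteq> e"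
      by (auto simp: adj_def)
    from Suc.IH[OF w] show ?case
    proof
      assume "l = 0 \<and> u = w"
      then show ?thesis using e by (intro disjI2 exI[of _ "{e}"]) (auto intro: connected_edges.single)
    next
      assume "\<exists>P. connected_edges P \<and> P \<subseteq> E \<and> (A \<noteq> {} \<longrightarrow> (\<forall>e\<in>P. \<not> A \<subseteq> e)) \<and> finite P
        \<and> card P \<le> l \<and> u \<in> \<Union>P \<and> w \<in> \<Union>P"
      then obtain P where P: "connected_edges P" "P \<subseteq> E" "A \<noteq> {} \<longrightarrow> (\<forall>e\<in>P. \<not> A \<subseteq> e)" "finite P"
        "card P \<le> l" "u \<in> \<Union>P" "w \<in> \<Union>P" by blast
      have "connected_edges (insert e P)"
      proof (cases "e \<in> P")
        case False
        then show ?thesis using P e by (intro connected_edges.insert) auto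
      qed (use P in \<open>simp add: insert_absorb\<close>)
      moreover have "card (insert e P) \<le> Suc l" using P by (simp add: card_insert_if)
      ultimately show ?thesis using P e by (intro disjI2 exI[of _ "insert e P"]) auto
    qed
  qed simp
  with assms(2) that show ?thesis by blast
qed

text \<open>Edges of the walk are absorbed into \<open>A\<close> one at a time. Each shares the
  current vertex with \<open>A\<close> and costs nothing; the first one meeting the span of
  \<open>B\<close> also shares a vertex with \<open>B\<close>, which gains 1.\<close>

lemma walk_join_excess:
  assumes "(u, v) \<in> adj E {} ^^ l" and "uniform s E" and "A \<subseteq> E" and "B \<subseteq> E"
    and "\<Union>A \<inter> \<Union>B = {}" and "u \<in> \<Union>A" and "v \<in> \<Union>B"
  shows "\<exists>Q\<subseteq>E. card Q \<le> l \<and> excess s (A \<union> B \<union> Q) \<ge> excess s A + excess s B + 1"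
  using assms
proof (induction l arbitrary: u A)
  case 0
  then show ?case by auto
next
  case (Suc l)
  obtain w f where w: "(w, v) \<in> adj E {} ^^ l" and f: "f \<in> E" "u \<in> f" "w \<in> f"
    using relpow_Suc_D2[OF Suc.prems(1)] by (auto simp: adj_def)
  have uA: "uniform s A" "uniform s B" using Suc.prems by (auto intro: uniform_subset)
  show ?case
  proof (cases "f \<in> A")
    case True
    then have "w \<in> \<Union>A" using f by blast
    from Suc.IH[OF w Suc.prems(2-5) this Suc.prems(7)] show ?thesis using le_SucI by blast
  next
    case fA: False
    have fB: "f \<notin> B" using Suc.prems f by blast
    have uf: "uniform s (insert f A)" "uniform s (insert f (A \<union> B))"
      using Suc.prems f by (auto intro: uniform_subset[OF Suc.prems(2)])
    show ?thesis
    proof (cases "f \<inter> \<Union>B = {}")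
      case True
      have 1: "excess s (insert f A) \<ge> excess s A"
        using excess_insert_ge[OF uf(1) fA, of "{u}" 1] Suc.prems f by force
      have "\<exists>Q\<subseteq>E. card Q \<le> l \<and>
          excess s (insert f A \<union> B \<union> Q) \<ge> excess s (insert f A) + excess s B + 1"
        using Suc.prems f True by (intro Suc.IH[OF w]) auto
      then obtain Q where Q: "Q \<subseteq> E" "card Q \<le> l"
        "excess s (insert f A \<union> B \<union> Q) \<ge> excess s (insert f A) + excess s B + 1" by blast
      have "A \<union> B \<union> insert f Q = insert f A \<union> B \<union> Q" by auto
      moreover have "card (insert f Q) \<le> Suc l"
        using Q finite_subset[OF Q(1) uniform_finite[OF Suc.prems(2)]] by (simp add: card_insert_if)
      ultimately show ?thesis using Q 1 f by (intro exI[of _ "insert f Q"]) auto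
    next
      case False
      then obtain b where b: "b \<in> f" "b \<in> \<Union>B" by blast
      have "b \<noteq> u" using b Suc.prems by blast
      then have "excess s (insert f (A \<union> B)) \<ge> excess s (A \<union> B) + 1"
        using excess_insert_ge[OF uf(2), of "{u, b}" 2] Suc.prems f b fA fB by force
      moreover have "excess s (A \<union> B) = excess s A + excess s B"
      proof -
        have "excess s (A - B \<union> B) = excess s (A - B) + excess s B + int (card (\<Union>(A - B) \<inter> \<Union>B))"
          using uA by (intro excess_disjoint_Un) (auto intro: uniform_subset)
        moreover have "\<Union>(A - B) \<inter> \<Union>B = {}" using Suc.prems(5) by blast
        \<comment> \<open>For \<open>s > 0\<close> edges are nonempty, so a common edge would put a
          vertex in both spans. For \<open>s = 0\<close> the span of \<open>A\<close> could not
          contain \<open>u\<close>.\<close>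
        moreover have "excess s (A - B) = excess s A"
        proof (cases "s = 0")
          case True
          then have "A \<subseteq> {{}}" using uA by (auto simp: uniform_def)
          then show ?thesis using Suc.prems(6) by auto
        next
          case False
          then have "A - B = A" using uA Suc.prems(5) unfolding uniform_def
            by (metis Diff_triv Int_emptyI Union_disjoint card.empty inf.idem inf_commute)
          then show ?thesis by simp
        qed
        ultimately show ?thesis by simp
      qed
      ultimately show ?thesis using f by (intro exI[of _ "{f}"]) auto
    qed
  qed
qed

section \<open>The pattern and its excess\<close>

text \<open>The two edges through \<open>p\<close> and \<open>q\<close> are told apart by
  \<open>x\<close>, which also starts the walk to \<open>y\<close>; so the double edge needs no
  vertex beyond \<open>x\<close>, \<open>p\<close>, \<open>q\<close>.\<close>

definition pattern :: "'v set set \<Rightarrow> nat \<Rightarrow> nat \<Rightarrow> nat \<Rightarrow> 'v \<Rightarrow> bool" where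
  "pattern E l1 l2 c y \<longleftrightarrow>
     (\<exists>x. (x, y) \<in> adj E {} ^^ l1 \<and>
        (\<exists>p q. x \<noteq> p \<and> x \<noteq> q \<and> p \<noteq> q \<and>
          (\<exists>e\<in>E. x \<in> e \<and> p \<in> e \<and> q \<in> e) \<and> (\<exists>e\<in>E. p \<in> e \<and> q \<in> e \<and> x \<notin> e))) \<and>
     (\<exists>x. (y, x) \<in> adj E {} ^^ l2 \<and> (\<exists>z. (x, z) \<in> adj E {} \<and> (x, z) \<in> adj E {x, z} ^^ c))"

text \<open>The double edge and the closed walk each have excess at least 0. If they share no edge,
  a common vertex or the walk joining them supplies the missing 1; if they share edges, the
  coincidences are counted inside the closed walk itself. The bound on edges is the two walks to
  \<open>y\<close>, the walk of length \<open>c\<close>, the edge \<open>e\<close> and the two edges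
  \<open>e1\<close>, \<open>e2\<close>.\<close>

lemma pattern_excess:
  assumes "pattern E l1 l2 c y" and "uniform s E"
  shows "\<exists>F\<subseteq>E. F \<noteq> {} \<and> card F \<le> l1 + l2 + c + 3 \<and> excess s F \<ge> 1"
proof -
  from assms(1) obtain x p q e1 e2 x' z e where
    x: "(x, y) \<in> adj E {} ^^ l1" and e1: "e1 \<in> E" "x \<in> e1" "p \<in> e1" "q \<in> e1"
    and e2: "e2 \<in> E" "p \<in> e2" "q \<in> e2" "x \<notin> e2" and "p \<noteq> q"
    and x': "(y, x') \<in> adj E {} ^^ l2" and e: "e \<in> E" "x' \<in> e" "z \<in> e" and "x' \<noteq> z"
    and z: "(x', z) \<in> adj E {x', z} ^^ c"
    unfolding pattern_def by (auto simp: adj_def)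
  obtain P where P: "connected_edges P" "P \<subseteq> E" "\<forall>e\<in>P. \<not> {x', z} \<subseteq> e" "finite P"
    "card P \<le> c" "x' \<in> \<Union>P" "z \<in> \<Union>P"
    using walk_connected_edges[OF z \<open>x' \<noteq> z\<close>] by (metis insert_not_empty)
  have eP: "e \<notin> P" using P e by blast
  have fin: "finite g" if "g \<in> E" for g using that assms(2) by (auto simp: uniform_def)
  have U: "uniform s F" if "F \<subseteq> E" for F using that assms(2) by (rule uniform_subset[rotated])
  have "e1 \<noteq> e2" using e1 e2 by blast
  have e12: "card (e1 \<inter> e2) \<ge> 2"
    using card_mono[of "e1 \<inter> e2" "{p, q}"] e1 e2 fin \<open>p \<noteq> q\<close> by auto
  note PE = connected_edges_excess[OF P(1) U[OF P(2)]]
  let ?F2 = "insert e P"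
  have uF2: "uniform s ?F2" using e P by (intro U) auto
  have cF2: "card ?F2 \<le> c + 1" using P eP by simp
  have exF2: "excess s ?F2 \<ge> excess s P + 1"
    using excess_insert_ge[OF uF2 eP, of "{x', z}" 2] e P \<open>x' \<noteq> z\<close> by force
  \<comment> \<open>The edge \<open>f\<close> misses one of \<open>x'\<close>, \<open>z\<close>, yet
    both lie in \<open>e\<close> and in the span of \<open>P\<close>. So \<open>e\<close> meets that
    span in at least three vertices and adds 2 to an excess of at least -1.\<close>
  have in_cycle: "excess s ?F2 \<ge> 1" if "f \<in> P" "card (e \<inter> f) \<ge> 2" for f
  proof -
    have fe: "finite e" using e fin by blast
    have "\<not> {x', z} \<subseteq> e \<inter> f" using P that by blast
    then have "e \<inter> f \<subset> e \<inter> f \<union> {x', z}" by blast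
    then have "card (e \<inter> f) < card (e \<inter> f \<union> {x', z})"
      using fe by (intro psubset_card_mono) auto
    then have "card (e \<inter> f \<union> {x', z}) \<ge> 3" using that by linarith
    then show ?thesis
      using excess_insert_ge[OF uF2 eP, of "e \<inter> f \<union> {x', z}" 3] e P that PE by force
  qed
  \<comment> \<open>Closing the walk with \<open>e\<close> already gives excess at least 0; one more
    edge with two vertices in the span reaches 1.\<close>
  have add_one: "excess s (insert g ?F2) \<ge> 1" if "g \<notin> ?F2" "g \<in> E" "f \<in> ?F2" "card (g \<inter> f) \<ge> 2" for f g
  proof -
    have "uniform s (insert g ?F2)" using that e P by (intro U) auto
    then show ?thesis
      using excess_insert_ge[of s g ?F2 "g \<inter> f" 2] that exF2 PE by force
  qed
  have sub: "?thesis" if "excess s F \<ge> 1" "F \<subseteq> E" "F \<noteq> {}" "card F \<le> c + 2" for F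
    using that by (intro exI[of _ F]) auto
  \<comment> \<open>The edges of the double edge may themselves occur in the closed walk, so the two
    parts need not be edge-disjoint.\<close>
  consider "e1 \<in> ?F2" "e2 \<in> ?F2" | "e1 \<in> ?F2" "e2 \<notin> ?F2" | "e1 \<notin> ?F2" "e2 \<in> ?F2"
    | "e1 \<notin> ?F2" "e2 \<notin> ?F2" by blast
  then show ?thesis
  proof cases
    case 1
    then consider "e1 \<in> P" "e2 \<in> P" | "e1 = e" "e2 \<in> P" | "e2 = e" "e1 \<in> P"
      using \<open>e1 \<noteq> e2\<close> by blast
    then have "excess s ?F2 \<ge> 1"
    proof cases
      case 1
      then have "excess s P \<ge> 0" using PE e12 \<open>e1 \<noteq> e2\<close> by blast
      then show ?thesis using exF2 by linarith
    qed (use in_cycle e12 in \<open>auto simp: Int_commute\<close>)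
    then show ?thesis using cF2 e P by (intro sub[of ?F2]) auto
  next
    case 2
    then have "excess s (insert e2 ?F2) \<ge> 1" using add_one[of e2 e1] e12 e2 by (simp add: Int_commute)
    moreover have "card (insert e2 ?F2) \<le> c + 2" using cF2 2 P by simp
    ultimately show ?thesis using e2 e P by (intro sub[of "insert e2 ?F2"]) auto
  next
    case 3
    then have "excess s (insert e1 ?F2) \<ge> 1" using add_one[of e1 e2] e12 e1 by simp
    moreover have "card (insert e1 ?F2) \<le> c + 2" using cF2 3 P by simp
    ultimately show ?thesis using e1 e P by (intro sub[of "insert e1 ?F2"]) auto
  next
    case 4
    let ?F1 = "{e1, e2}"
    have uF1: "uniform s ?F1" using e1 e2 by (intro U) auto
    have exF1: "excess s ?F1 \<ge> 0"
      using excess_insert_ge[of s e1 "{e2}" "e1 \<inter> e2" 2] uF1 \<open>e1 \<noteq> e2\<close> e12 e2 assms(2)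
      by (simp add: excess_def uniform_def)
    have cF1: "card ?F1 = 2" using \<open>e1 \<noteq> e2\<close> by simp
    have c12: "card (?F1 \<union> ?F2) \<le> c + 3"
      using card_Un_le[of ?F1 ?F2] cF1 cF2 by linarith
    show ?thesis
    proof (cases "\<Union>?F1 \<inter> \<Union>?F2 = {}")
      case True
      have "(x, x') \<in> adj E {} ^^ (l1 + l2)"
        using x x' by (auto simp: relpow_add)
      from walk_join_excess[OF this assms(2) _ _ True] obtain Q where
        Q: "Q \<subseteq> E" "card Q \<le> l1 + l2" "excess s (?F1 \<union> ?F2 \<union> Q) \<ge> excess s ?F1 + excess s ?F2 + 1"
        using e1 e2 e P by auto
      have "card (?F1 \<union> ?F2 \<union> Q) \<le> l1 + l2 + c + 3"
        using card_Un_le[of "?F1 \<union> ?F2" Q] c12 Q by linarith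
      then show ?thesis using Q exF1 exF2 PE e e1 e2 P
        by (intro exI[of _ "?F1 \<union> ?F2 \<union> Q"]) auto
    next
      case False
      have "finite (\<Union>?F1 \<inter> \<Union>?F2)" using uniform_finite_Union[OF uF1] by simp
      then have "card (\<Union>?F1 \<inter> \<Union>?F2) \<ge> 1" using False by (simp only: card_gt_0_iff One_nat_def Suc_le_eq) simp
      moreover have "excess s (?F1 \<union> ?F2) = excess s ?F1 + excess s ?F2 + int (card (\<Union>?F1 \<inter> \<Union>?F2))"
        using 4 by (intro excess_disjoint_Un uF1 uF2) auto
      ultimately have "excess s (?F1 \<union> ?F2) \<ge> 1" using exF1 exF2 PE by linarith
      then show ?thesis using c12 e e1 e2 P by (intro exI[of _ "?F1 \<union> ?F2"]) auto
    qed
  qed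
qed

section \<open>A formula for the dumbbell\<close>

abbreviation ex_list :: "nat list \<Rightarrow> fo_formula \<Rightarrow> fo_formula" where
  "ex_list vs \<phi> \<equiv> foldr Ex vs \<phi>"

lemma satisfies_ex_list:
  "satisfies V E \<sigma> (ex_list vs \<phi>) \<longleftrightarrow>
     (\<exists>\<tau>. (\<forall>i. i \<notin> set vs \<longrightarrow> \<tau> i = \<sigma> i) \<and> (\<forall>i\<in>set vs. \<tau> i \<in> V) \<and> satisfies V E \<tau> \<phi>)"
proof (induction vs arbitrary: \<sigma>)
  case Nil
  have "(\<forall>i. \<tau> i = \<sigma> i) \<longleftrightarrow> \<tau> = \<sigma>" for \<tau> by auto
  then show ?case by simp
next
  case (Cons v vs)
  show ?case
  proof
    assume "satisfies V E \<sigma> (ex_list (v # vs) \<phi>)"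
    then obtain u \<tau> where "u \<in> V" "\<forall>i. i \<notin> set vs \<longrightarrow> \<tau> i = (\<sigma>(v := u)) i" "\<forall>i\<in>set vs. \<tau> i \<in> V"
      "satisfies V E \<tau> \<phi>" by (auto simp: Cons.IH)
    then show "\<exists>\<tau>. (\<forall>i. i \<notin> set (v # vs) \<longrightarrow> \<tau> i = \<sigma> i) \<and> (\<forall>i\<in>set (v # vs). \<tau> i \<in> V) \<and> satisfies V E \<tau> \<phi>"
      by (intro exI[of _ \<tau>]) (cases "v \<in> set vs"; auto)
  next
    assume "\<exists>\<tau>. (\<forall>i. i \<notin> set (v # vs) \<longrightarrow> \<tau> i = \<sigma> i) \<and> (\<forall>i\<in>set (v # vs). \<tau> i \<in> V) \<and> satisfies V E \<tau> \<phi>"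
    then obtain \<tau> where "\<forall>i. i \<notin> set (v # vs) \<longrightarrow> \<tau> i = \<sigma> i" "\<forall>i\<in>set (v # vs). \<tau> i \<in> V" "satisfies V E \<tau> \<phi>"
      by blast
    then show "satisfies V E \<sigma> (ex_list (v # vs) \<phi>)"
      by (auto simp: Cons.IH intro!: bexI[of _ "\<tau> v"] exI[of _ \<tau>])
  qed
qed

lemma ex_list_syntax [simp]:
  "of_arity s (ex_list vs \<phi>) = of_arity s \<phi>"
  "free_vars (ex_list vs \<phi>) = free_vars \<phi> - set vs"
  "quantifier_depth (ex_list vs \<phi>) = length vs + quantifier_depth \<phi>"
  by (induction vs) auto

definition mem_fm :: "nat \<Rightarrow> nat list \<Rightarrow> fo_formula" where
  "mem_fm u l = foldr (\<lambda>v \<phi>. Disj (Eq u v) \<phi>) l (Neg (Eq u u))"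

lemma mem_fm [simp]:
  "satisfies V E \<sigma> (mem_fm u l) \<longleftrightarrow> \<sigma> u \<in> \<sigma> ` set l"
  "of_arity s (mem_fm u l)" "free_vars (mem_fm u l) = insert u (set l)"
  "quantifier_depth (mem_fm u l) = 0"
  unfolding mem_fm_def by (induction l) auto

definition contains_fm :: "nat list \<Rightarrow> nat list \<Rightarrow> fo_formula" where
  "contains_fm as l = foldr (\<lambda>u \<phi>. Conj (mem_fm u l) \<phi>) as (N l)"

lemma contains_fm [simp]:
  "satisfies V E \<sigma> (contains_fm as l) \<longleftrightarrow> \<sigma> ` set as \<subseteq> \<sigma> ` set l \<and> \<sigma> ` set l \<in> E"
  "of_arity s (contains_fm as l) \<longleftrightarrow> length l = s" "free_vars (contains_fm as l) = set as \<union> set l"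
  "quantifier_depth (contains_fm as l) = 0"
  unfolding contains_fm_def by (induction as) auto

text \<open>
  Variables below 10 are reserved for the named vertices of the pattern, the block
  \<open>{10..<10+s}\<close> lists the remaining vertices of an edge, and larger variables are
  midpoints of walks.
\<close>

definition edge_fm :: "nat \<Rightarrow> nat list \<Rightarrow> nat list \<Rightarrow> fo_formula" where
  "edge_fm s as xs = (let vs = [10..<10 + (s - length xs)]; l = xs @ vs in
     ex_list vs (if as = [] then N l else Conj (N l) (Neg (contains_fm as l))))"

lemma edge_fm_syntax:
  assumes "length xs \<le> s"
  shows "of_arity s (edge_fm s as xs)" "free_vars (edge_fm s as xs) \<subseteq> set xs \<union> set as"
    "quantifier_depth (edge_fm s as xs) = s - length xs"
  using assms by (auto simp: edge_fm_def Let_def)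

text \<open>Edges have \<open>s\<close> elements and the atom lists \<open>s\<close> distinct
  variables, so the atom forces their values to be pairwise distinct. No inequality atoms are
  written, and injectivity on \<open>xs\<close> comes for free.\<close>

lemma satisfies_edge_fm:
  assumes E: "\<forall>e\<in>E. e \<subseteq> V \<and> finite e \<and> card e = s"
    and fresh: "(set xs \<union> set as) \<inter> {10..<10 + s} = {}" and "distinct xs" and "length xs \<le> s"
  shows "satisfies V E \<sigma> (edge_fm s as xs) \<longleftrightarrow>
    inj_on \<sigma> (set xs) \<and>
    (\<exists>e\<in>E. \<sigma> ` set xs \<subseteq> e \<and> (\<sigma> ` set as = {} \<or> \<not> \<sigma> ` set as \<subseteq> e))"
proof -
  define vs where "vs = [10..<10 + (s - length xs)]"
  have fx: "set xs \<inter> set vs = {}" and fa: "set as \<inter> set vs = {}"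
    using fresh by (auto simp: vs_def disjoint_iff)
  have dist: "distinct (xs @ vs)" and len: "length (xs @ vs) = s"
    using fx assms by (auto simp: vs_def)
  have "satisfies V E \<sigma> (edge_fm s as xs) \<longleftrightarrow>
     (\<exists>\<tau>. (\<forall>i. i \<notin> set vs \<longrightarrow> \<tau> i = \<sigma> i) \<and> (\<forall>i\<in>set vs. \<tau> i \<in> V) \<and>
        \<tau> ` set (xs @ vs) \<in> E \<and> (as = [] \<or> \<not> \<tau> ` set as \<subseteq> \<tau> ` set (xs @ vs)))" (is "_ \<longleftrightarrow> ?R")
    unfolding edge_fm_def Let_def vs_def[symmetric] satisfies_ex_list
    by (intro ex_cong1 conj_cong refl) auto
  also have "?R \<longleftrightarrow> inj_on \<sigma> (set xs) \<and>
    (\<exists>e\<in>E. \<sigma> ` set xs \<subseteq> e \<and> (\<sigma> ` set as = {} \<or> \<not> \<sigma> ` set as \<subseteq> e))"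
  proof
    assume ?R
    then obtain \<tau> where \<tau>: "\<forall>i. i \<notin> set vs \<longrightarrow> \<tau> i = \<sigma> i" "\<tau> ` set (xs @ vs) \<in> E"
      "as = [] \<or> \<not> \<tau> ` set as \<subseteq> \<tau> ` set (xs @ vs)" by blast
    have tx: "\<tau> ` set xs = \<sigma> ` set xs" and ta: "\<tau> ` set as = \<sigma> ` set as"
      and txi: "\<And>i. i \<in> set xs \<Longrightarrow> \<tau> i = \<sigma> i"
      using \<tau>(1) fx fa by (auto intro!: image_cong)
    have "card (\<tau> ` set (xs @ vs)) = card (set (xs @ vs))"
      using \<tau>(2) E dist len distinct_card by metis
    then have "inj_on \<tau> (set (xs @ vs))" by (intro eq_card_imp_inj_on) auto
    then have "inj_on \<tau> (set xs)" by (auto simp: inj_on_def)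
    then have "inj_on \<sigma> (set xs)" using txi by (simp add: inj_on_def)
    then show "inj_on \<sigma> (set xs) \<and>
      (\<exists>e\<in>E. \<sigma> ` set xs \<subseteq> e \<and> (\<sigma> ` set as = {} \<or> \<not> \<sigma> ` set as \<subseteq> e))"
      using \<tau>(2,3) tx ta by (intro conjI bexI[of _ "\<tau> ` set (xs @ vs)"]) auto
  next
    assume "inj_on \<sigma> (set xs) \<and>
      (\<exists>e\<in>E. \<sigma> ` set xs \<subseteq> e \<and> (\<sigma> ` set as = {} \<or> \<not> \<sigma> ` set as \<subseteq> e))"
    then obtain e where inj: "inj_on \<sigma> (set xs)" and e: "e \<in> E" "\<sigma> ` set xs \<subseteq> e"
      "\<sigma> ` set as = {} \<or> \<not> \<sigma> ` set as \<subseteq> e" by blast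
    have fe: "finite e" "card e = s" "e \<subseteq> V" using E e by auto
    have "card (e - \<sigma> ` set xs) = s - length xs"
      using fe e inj \<open>distinct xs\<close> by (simp add: card_Diff_subset card_image distinct_card)
    also have "\<dots> = card (set vs)" by (simp add: vs_def)
    finally obtain h where h: "bij_betw h (set vs) (e - \<sigma> ` set xs)"
      using fe by (metis finite_same_card_bij List.finite_set finite_Diff)
    define \<tau> where "\<tau> i = (if i \<in> set vs then h i else \<sigma> i)" for i
    have tx: "\<tau> ` set xs = \<sigma> ` set xs" "\<tau> ` set as = \<sigma> ` set as" 
      using fx fa by (auto simp: \<tau>_def intro!: image_cong)
    have tv: "\<tau> ` set vs = e - \<sigma> ` set xs"
      using h by (auto simp: \<tau>_def bij_betw_def)
    have "\<tau> ` set (xs @ vs) = e" unfolding set_append image_Un tx(1) tv using e(2) by blast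
    then show ?R using tx tv e fe
      by (intro exI[of _ \<tau>]) (auto simp: \<tau>_def)
  qed
  finally show ?thesis .
qed

text \<open>One quantifier names a midpoint and serves both halves, so the depth grows by 1 while
  the length doubles. The base case reads every positive \<open>l\<close> as 1, which is right as
  long as the initial length is at most \<open>2 ^ t\<close>. The midpoint variable depends on the
  level, so inner levels do not capture outer midpoints.\<close>

fun walk_fm :: "nat \<Rightarrow> nat list \<Rightarrow> nat \<Rightarrow> nat \<Rightarrow> nat \<Rightarrow> nat \<Rightarrow> fo_formula" where
  "walk_fm s as 0 l x y = (if l = 0 then Eq x y else edge_fm s as [x, y])"
| "walk_fm s as (Suc t) l x y = (let z = 10 + s + t in
     Ex z (Conj (walk_fm s as t (l div 2) x z) (walk_fm s as t (l - l div 2) z y)))"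

lemma walk_fm_syntax:
  assumes "s \<ge> 2"
  shows "of_arity s (walk_fm s as t l x y) \<and> free_vars (walk_fm s as t l x y) \<subseteq> {x, y} \<union> set as \<and>
    quantifier_depth (walk_fm s as t l x y) \<le> t + (s - 2)"
proof (induction t arbitrary: l x y)
  case 0
  show ?case using assms edge_fm_syntax[of "[x, y]" s as] by (auto simp: numeral_2_eq_2)
next
  case (Suc t)
  show ?case
    using Suc.IH[of "l div 2" x "10 + s + t"] Suc.IH[of "l - l div 2" "10 + s + t" y]
    by (auto simp: Let_def)
qed

lemma satisfies_walk_fm:
  assumes E: "\<forall>e\<in>E. e \<subseteq> V \<and> finite e \<and> card e = s" and "s \<ge> 2"
    and "({x, y} \<union> set as) \<inter> {10..<10 + s + t} = {}" and "x \<noteq> y"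
    and "\<sigma> x \<in> V" and "\<sigma> y \<in> V" and "l \<le> 2 ^ t"
  shows "satisfies V E \<sigma> (walk_fm s as t l x y) \<longleftrightarrow> (\<sigma> x, \<sigma> y) \<in> adj E (\<sigma> ` set as) ^^ l"
  using assms(3-)
proof (induction t arbitrary: l x y \<sigma>)
  case 0
  then consider "l = 0" | "l = 1" by force
  then show ?case
  proof cases
    case 2
    have "satisfies V E \<sigma> (edge_fm s as [x, y]) \<longleftrightarrow> inj_on \<sigma> (set [x, y]) \<and>
      (\<exists>e\<in>E. \<sigma> ` set [x, y] \<subseteq> e \<and> (\<sigma> ` set as = {} \<or> \<not> \<sigma> ` set as \<subseteq> e))"
      using 0 \<open>s \<ge> 2\<close> by (intro satisfies_edge_fm E) auto
    then show ?thesis using 2 \<open>x \<noteq> y\<close> by (auto simp: adj_def)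
  qed auto
next
  case (Suc t)
  define z where "z = 10 + s + t"
  have fr: "x \<noteq> z" "y \<noteq> z" "z \<notin> set as" "({x, z} \<union> set as) \<inter> {10..<10 + s + t} = {}"
     "({z, y} \<union> set as) \<inter> {10..<10 + s + t} = {}"
    using Suc.prems(1) by (auto simp: z_def disjoint_iff)
  have im: "(\<sigma>(z := u)) ` set as = \<sigma> ` set as" for u using fr by (auto intro!: image_cong)
  have l: "l div 2 \<le> 2 ^ t" "l - l div 2 \<le> 2 ^ t" using Suc.prems by auto
  have "satisfies V E \<sigma> (walk_fm s as (Suc t) l x y) \<longleftrightarrow>
    (\<exists>u\<in>V. (\<sigma> x, u) \<in> adj E (\<sigma> ` set as) ^^ (l div 2) \<and> (u, \<sigma> y) \<in> adj E (\<sigma> ` set as) ^^ (l - l div 2))"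
    unfolding walk_fm.simps Let_def z_def[symmetric] satisfies.simps
  proof (intro bex_cong refl arg_cong2[where f = "(\<and>)"])
    fix u assume "u \<in> V"
    show "satisfies V E (\<sigma>(z := u)) (walk_fm s as t (l div 2) x z) =
      ((\<sigma> x, u) \<in> adj E (\<sigma> ` set as) ^^ (l div 2))"
    proof -
      have "satisfies V E (\<sigma>(z := u)) (walk_fm s as t (l div 2) x z) \<longleftrightarrow>
        ((\<sigma>(z := u)) x, (\<sigma>(z := u)) z) \<in> adj E ((\<sigma>(z := u)) ` set as) ^^ (l div 2)"
        by (rule Suc.IH) (use fr l Suc.prems \<open>u \<in> V\<close> in simp_all)
      then show ?thesis unfolding im using fr by simp
    qed
    show "satisfies V E (\<sigma>(z := u)) (walk_fm s as t (l - l div 2) z y) =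
      ((u, \<sigma> y) \<in> adj E (\<sigma> ` set as) ^^ (l - l div 2))"
    proof -
      have "satisfies V E (\<sigma>(z := u)) (walk_fm s as t (l - l div 2) z y) \<longleftrightarrow>
        ((\<sigma>(z := u)) z, (\<sigma>(z := u)) y) \<in> adj E ((\<sigma>(z := u)) ` set as) ^^ (l - l div 2)"
        by (rule Suc.IH) (use fr l Suc.prems \<open>u \<in> V\<close> in simp_all)
      then show ?thesis unfolding im using fr by simp
    qed
  qed
  also have "\<dots> \<longleftrightarrow> (\<exists>u. (\<sigma> x, u) \<in> adj E (\<sigma> ` set as) ^^ (l div 2) \<and>
      (u, \<sigma> y) \<in> adj E (\<sigma> ` set as) ^^ (l - l div 2))"
  \<comment> \<open>The quantifier ranges over \<open>V\<close> but the relation does not mention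
    it: the end of a nonempty walk lies in an edge, and an empty walk ends at its start.\<close>
  proof -
    have "u \<in> V" if "(\<sigma> x, u) \<in> adj E (\<sigma> ` set as) ^^ i" for u i
      using that Suc.prems E by (cases i) (auto simp: adj_def)
    then show ?thesis by blast
  qed
  also have "\<dots> \<longleftrightarrow> (\<sigma> x, \<sigma> y) \<in> adj E (\<sigma> ` set as) ^^ (l div 2 + (l - l div 2))"
    unfolding relpow_add by blast
  finally show ?case by simp
qed

text \<open>Depth budget \<open>s + t\<close>: \<open>y\<close>, \<open>x\<close> and a walk of
  depth \<open>t + (s - 2)\<close> exhaust it. The cycle names one more vertex \<open>z\<close>, so
  its walk has only \<open>t - 1\<close> halvings. The variable 1 is reused for the two ends of the
  dumbbell.\<close>

definition pattern_fm :: "nat \<Rightarrow> nat \<Rightarrow> nat \<Rightarrow> nat \<Rightarrow> nat \<Rightarrow> fo_formula" where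
  "pattern_fm s t l1 l2 c = Ex 0 (Conj
     (Ex 1 (Conj (walk_fm s [] t l1 1 0)
       (Ex 2 (Ex 3 (Conj (edge_fm s [] [1, 2, 3]) (edge_fm s [1] [2, 3]))))))
     (Ex 1 (Conj (walk_fm s [] t l2 0 1)
       (Ex 2 (Conj (edge_fm s [] [1, 2]) (walk_fm s [1, 2] (t - 1) c 1 2))))))"

lemma pattern_fm_syntax:
  assumes "s \<ge> 3" and "t \<ge> 2"
  shows "of_arity s (pattern_fm s t l1 l2 c)" "free_vars (pattern_fm s t l1 l2 c) = {}"
    "quantifier_depth (pattern_fm s t l1 l2 c) \<le> s + t"
proof -
  have "s \<ge> 2" using assms by simp
  note w = walk_fm_syntax[OF this, of "[]" t l1 1 0] walk_fm_syntax[OF this, of "[]" t l2 0 1]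
    walk_fm_syntax[OF this, of "[1, 2]" "t - 1" c 1 2]
  note e = edge_fm_syntax[of "[1, 2, 3]" s "[]"] edge_fm_syntax[of "[2, 3]" s "[1]"]
    edge_fm_syntax[of "[1, 2]" s "[]"]
  show "of_arity s (pattern_fm s t l1 l2 c)"
    using w e assms by (simp add: pattern_fm_def)
  show "free_vars (pattern_fm s t l1 l2 c) = {}"
    using w e assms by (simp add: pattern_fm_def) blast
  show "quantifier_depth (pattern_fm s t l1 l2 c) \<le> s + t"
  proof -
    have bound: "Suc (max (Suc (max a (Suc (Suc (max b c))))) (Suc (max d (Suc (max e f))))) \<le> r"
      if "a + 2 \<le> r" "b + 4 \<le> r" "c + 4 \<le> r" "d + 2 \<le> r" "e + 3 \<le> r" "f + 3 \<le> r"
      for a b c d e f r :: nat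
      using that by (auto simp: max_def)
    show ?thesis
      unfolding pattern_fm_def quantifier_depth.simps by (rule bound) (use w e assms in auto)
  qed
qed

lemma satisfies_pattern_fm:
  assumes E: "\<forall>e\<in>E. e \<subseteq> V \<and> finite e \<and> card e = s" and "s \<ge> 3"
    and "l1 \<le> 2 ^ t" and "l2 \<le> 2 ^ t" and "c \<le> 2 ^ (t - 1)"
  shows "satisfies V E \<sigma> (pattern_fm s t l1 l2 c) \<longleftrightarrow> (\<exists>y\<in>V. pattern E l1 l2 c y)"
proof -
  have s2: "s \<ge> 2" using assms by simp
  have step: "u \<in> V" "v \<in> V" if "(u, v) \<in> adj E A" for u v A using that E by (auto simp: adj_def)
  have walk_end: "v \<in> V" if "(u, v) \<in> adj E A ^^ l" "u \<in> V" for u v A l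
    using that step(2) by (cases l) auto
  have walk_start: "v \<in> V" if "(v, u) \<in> adj E A ^^ l" "u \<in> V" for u v A l
    using that step(1) by (cases l) (auto dest!: relpow_Suc_D2 simp del: relpow.simps(2))
  have left: "satisfies V E (\<sigma>(0 := y)) (Ex 1 (Conj (walk_fm s [] t l1 1 0)
       (Ex 2 (Ex 3 (Conj (edge_fm s [] [1, 2, 3]) (edge_fm s [1] [2, 3])))))) \<longleftrightarrow>
     (\<exists>x. (x, y) \<in> adj E {} ^^ l1 \<and>
        (\<exists>p q. x \<noteq> p \<and> x \<noteq> q \<and> p \<noteq> q \<and>
          (\<exists>e\<in>E. x \<in> e \<and> p \<in> e \<and> q \<in> e) \<and> (\<exists>e\<in>E. p \<in> e \<and> q \<in> e \<and> x \<notin> e)))"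
    if y: "y \<in> V" for y
  proof -
    have w: "satisfies V E (\<sigma>(0 := y, 1 := x)) (walk_fm s [] t l1 1 0) \<longleftrightarrow> (x, y) \<in> adj E {} ^^ l1"
      if "x \<in> V" for x
      using satisfies_walk_fm[OF E s2, of 1 0 "[]" t "\<sigma>(0 := y, 1 := x)" l1] that y assms by simp
    have e: "satisfies V E (\<sigma>(0 := y, 1 := x, 2 := p, 3 := q)) (edge_fm s [] [1, 2, 3]) \<longleftrightarrow>
      x \<noteq> p \<and> x \<noteq> q \<and> p \<noteq> q \<and> (\<exists>e\<in>E. x \<in> e \<and> p \<in> e \<and> q \<in> e)" for x p q
      using satisfies_edge_fm[OF E, of "[1, 2, 3]" "[]" "\<sigma>(0 := y, 1 := x, 2 := p, 3 := q)"] assms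
      by auto
    have f: "satisfies V E (\<sigma>(0 := y, 1 := x, 2 := p, 3 := q)) (edge_fm s [1] [2, 3]) \<longleftrightarrow>
      p \<noteq> q \<and> (\<exists>e\<in>E. p \<in> e \<and> q \<in> e \<and> x \<notin> e)" for x p q
      using satisfies_edge_fm[OF E, of "[2, 3]" "[1]" "\<sigma>(0 := y, 1 := x, 2 := p, 3 := q)"] assms
      by auto
    show ?thesis
    proof -
      have "satisfies V E (\<sigma>(0 := y)) (Ex 1 (Conj (walk_fm s [] t l1 1 0)
         (Ex 2 (Ex 3 (Conj (edge_fm s [] [1, 2, 3]) (edge_fm s [1] [2, 3])))))) \<longleftrightarrow>
        (\<exists>x\<in>V. (x, y) \<in> adj E {} ^^ l1 \<and> (\<exists>p\<in>V. \<exists>q\<in>V.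
          (x \<noteq> p \<and> x \<noteq> q \<and> p \<noteq> q \<and> (\<exists>e\<in>E. x \<in> e \<and> p \<in> e \<and> q \<in> e)) \<and>
          p \<noteq> q \<and> (\<exists>e\<in>E. p \<in> e \<and> q \<in> e \<and> x \<notin> e)))"
        unfolding satisfies.simps e f by (intro bex_cong refl conj_cong w)
      also have "\<dots> \<longleftrightarrow> (\<exists>x. (x, y) \<in> adj E {} ^^ l1 \<and>
        (\<exists>p q. x \<noteq> p \<and> x \<noteq> q \<and> p \<noteq> q \<and>
          (\<exists>e\<in>E. x \<in> e \<and> p \<in> e \<and> q \<in> e) \<and> (\<exists>e\<in>E. p \<in> e \<and> q \<in> e \<and> x \<notin> e)))"
        using walk_start[OF _ y] E by (meson subsetD)
      finally show ?thesis .
    qed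
  qed
  have right: "satisfies V E (\<sigma>(0 := y)) (Ex 1 (Conj (walk_fm s [] t l2 0 1)
       (Ex 2 (Conj (edge_fm s [] [1, 2]) (walk_fm s [1, 2] (t - 1) c 1 2))))) \<longleftrightarrow>
     (\<exists>x. (y, x) \<in> adj E {} ^^ l2 \<and> (\<exists>z. (x, z) \<in> adj E {} \<and> (x, z) \<in> adj E {x, z} ^^ c))"
    if y: "y \<in> V" for y
  proof -
    have w: "satisfies V E (\<sigma>(0 := y, 1 := x)) (walk_fm s [] t l2 0 1) \<longleftrightarrow> (y, x) \<in> adj E {} ^^ l2"
      if "x \<in> V" for x
      using satisfies_walk_fm[OF E s2, of 0 1 "[]" t "\<sigma>(0 := y, 1 := x)" l2] that y assms by simp
    have e: "satisfies V E (\<sigma>(0 := y, 1 := x, 2 := z)) (edge_fm s [] [1, 2]) \<longleftrightarrow> (x, z) \<in> adj E {}" for x z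
      using satisfies_edge_fm[OF E, of "[1, 2]" "[]" "\<sigma>(0 := y, 1 := x, 2 := z)"] assms
      by (auto simp: adj_def)
    have w': "satisfies V E (\<sigma>(0 := y, 1 := x, 2 := z)) (walk_fm s [1, 2] (t - 1) c 1 2) \<longleftrightarrow>
       (x, z) \<in> adj E {x, z} ^^ c" if "x \<in> V" "z \<in> V" for x z
      using satisfies_walk_fm[OF E s2, of 1 2 "[1, 2]" "t - 1" "\<sigma>(0 := y, 1 := x, 2 := z)" c] that assms
      by simp
    show ?thesis
    proof -
      have "satisfies V E (\<sigma>(0 := y)) (Ex 1 (Conj (walk_fm s [] t l2 0 1)
         (Ex 2 (Conj (edge_fm s [] [1, 2]) (walk_fm s [1, 2] (t - 1) c 1 2))))) \<longleftrightarrow>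
        (\<exists>x\<in>V. (y, x) \<in> adj E {} ^^ l2 \<and> (\<exists>z\<in>V. (x, z) \<in> adj E {} \<and> (x, z) \<in> adj E {x, z} ^^ c))"
        unfolding satisfies.simps e by (intro bex_cong refl conj_cong w w')
      also have "\<dots> \<longleftrightarrow>
        (\<exists>x. (y, x) \<in> adj E {} ^^ l2 \<and> (\<exists>z. (x, z) \<in> adj E {} \<and> (x, z) \<in> adj E {x, z} ^^ c))"
        using walk_end[OF _ y] step(2) by meson
      finally show ?thesis .
    qed
  qed
  have "satisfies V E \<sigma> (pattern_fm s t l1 l2 c) \<longleftrightarrow> (\<exists>y\<in>V.
     satisfies V E (\<sigma>(0 := y)) (Ex 1 (Conj (walk_fm s [] t l1 1 0)
       (Ex 2 (Ex 3 (Conj (edge_fm s [] [1, 2, 3]) (edge_fm s [1] [2, 3])))))) \<and>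
     satisfies V E (\<sigma>(0 := y)) (Ex 1 (Conj (walk_fm s [] t l2 0 1)
       (Ex 2 (Conj (edge_fm s [] [1, 2]) (walk_fm s [1, 2] (t - 1) c 1 2))))))"
    unfolding pattern_fm_def by (simp only: satisfies.simps(4,9))
  then show ?thesis using left right unfolding pattern_def by (simp only: cong: bex_cong)
qed

lemma models_pattern_fm:
  assumes "E \<subseteq> possible_edges s n" and "s \<ge> 3" and "n \<ge> 1"
    and "l1 \<le> 2 ^ t" and "l2 \<le> 2 ^ t" and "c \<le> 2 ^ (t - 1)"
  shows "models {1..n} E (pattern_fm s t l1 l2 c) \<longleftrightarrow> (\<exists>y\<in>{1..n}. pattern E l1 l2 c y)"
proof -
  have E: "\<forall>e\<in>E. e \<subseteq> {1..n} \<and> finite e \<and> card e = s"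
    using assms(1) by (auto simp: possible_edges_def intro: finite_subset)
  \<comment> \<open>A sentence is tested under all assignments into the vertex set; for
    \<open>n \<ge> 1\<close> there is at least one, so the test is not vacuous.\<close>
  have "range (\<lambda>_. 1 :: nat) \<subseteq> {1..n}" using assms(3) by auto
  then show ?thesis unfolding models_def satisfies_pattern_fm[OF E assms(2,4-6)] by blast
qed

section \<open>Random edge sets\<close>

definition weight :: "real \<Rightarrow> 'a set \<Rightarrow> 'a set \<Rightarrow> real" where
  "weight p I S = p ^ card S * (1 - p) ^ card (I - S)"

definition expect :: "real \<Rightarrow> 'a set \<Rightarrow> ('a set \<Rightarrow> real) \<Rightarrow> real" where
  "expect p I f = (\<Sum>S\<in>Pow I. weight p I S * f S)"

lemma expect_cong: "(\<And>S. S \<subseteq> I \<Longrightarrow> f S = g S) \<Longrightarrow> expect p I f = expect p I g"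
  unfolding expect_def by (intro sum.cong) auto

lemma expect_mono:
  assumes "0 \<le> p" "p \<le> 1" "\<And>S. S \<subseteq> I \<Longrightarrow> f S \<le> g S"
  shows "expect p I f \<le> expect p I g"
  unfolding expect_def weight_def using assms by (intro sum_mono mult_left_mono) auto

lemma expect_linear:
  "expect p I (\<lambda>S. f S + g S) = expect p I f + expect p I g"
  "expect p I (\<lambda>S. f S - g S) = expect p I f - expect p I g"
  "expect p I (\<lambda>S. c * f S) = c * expect p I f"
  "expect p I (\<lambda>S. \<Sum>j\<in>J. h j S) = (\<Sum>j\<in>J. expect p I (h j))"
  unfolding expect_def
  by (simp_all add: algebra_simps sum.distrib sum_subtractf sum_distrib_left sum.swap[of _ J])

lemma expect_insert:
  assumes "finite I" and "i \<notin> I"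
  shows "expect p (insert i I) f = (1 - p) * expect p I f + p * expect p I (\<lambda>S. f (insert i S))"
proof -
  have "expect p (insert i I) f =
    (\<Sum>S\<in>Pow I. weight p (insert i I) S * f S) + (\<Sum>S\<in>insert i ` Pow I. weight p (insert i I) S * f S)"
    unfolding expect_def Pow_insert using assms by (intro sum.union_disjoint) auto
  also have "(\<Sum>S\<in>insert i ` Pow I. weight p (insert i I) S * f S) =
    (\<Sum>S\<in>Pow I. weight p (insert i I) (insert i S) * f (insert i S))"
    using assms by (subst sum.reindex) (auto simp: inj_on_def)
  also have "\<dots> = p * expect p I (\<lambda>S. f (insert i S))"
    unfolding expect_def sum_distrib_left
  proof (intro sum.cong refl)
    fix S assume "S \<in> Pow I"
    then have "finite S" "i \<notin> S" "insert i I - insert i S = I - S"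
      using assms by (auto intro: finite_subset)
    then show "weight p (insert i I) (insert i S) * f (insert i S) = p * (weight p I S * f (insert i S))"
      by (simp add: weight_def)
  qed
  also have "(\<Sum>S\<in>Pow I. weight p (insert i I) S * f S) = (1 - p) * expect p I f"
    unfolding expect_def sum_distrib_left
  proof (intro sum.cong refl)
    fix S assume "S \<in> Pow I"
    then have "insert i I - S = insert i (I - S)" "i \<notin> I - S" "finite (I - S)" using assms by auto
    then show "weight p (insert i I) S * f S = (1 - p) * (weight p I S * f S)"
      by (simp add: weight_def)
  qed
  finally show ?thesis .
qed

text \<open>Harris' inequality for two decreasing functions, by conditioning on whether
  \<open>i\<close> is present. The conditional expectations are again decreasing in the presence of
  \<open>i\<close>, so they are positively correlated.\<close>

lemma expect_harris:
  assumes "finite I" and p: "0 \<le> p" "p \<le> 1"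
    and "\<And>S T. S \<subseteq> T \<Longrightarrow> T \<subseteq> I \<Longrightarrow> f T \<le> f S" and "\<And>S T. S \<subseteq> T \<Longrightarrow> T \<subseteq> I \<Longrightarrow> g T \<le> g S"
  shows "expect p I f * expect p I g \<le> expect p I (\<lambda>S. f S * g S)"
  using assms(1,4,5)
proof (induction I arbitrary: f g rule: finite_induct)
  case empty
  show ?case by (simp add: expect_def weight_def)
next
  case (insert i I)
  let ?f = "\<lambda>S. f (insert i S)" and ?g = "\<lambda>S. g (insert i S)"
  let ?a = "expect p I f" and ?b = "expect p I ?f" and ?c = "expect p I g" and ?d = "expect p I ?g"
  have "?a * ?c \<le> expect p I (\<lambda>S. f S * g S)"
    by (intro insert.IH insert.prems) auto
  moreover have "?b * ?d \<le> expect p I (\<lambda>S. ?f S * ?g S)"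
    by (intro insert.IH insert.prems insert_mono) auto
  ultimately have "(1 - p) * (?a * ?c) + p * (?b * ?d) \<le> expect p (insert i I) (\<lambda>S. f S * g S)"
    unfolding expect_insert[OF insert.hyps] using p by (intro add_mono mult_left_mono) auto
  moreover have "?b \<le> ?a" "?d \<le> ?c"
    by (intro expect_mono p insert.prems; auto)+
  \<comment> \<open>This product is exactly the difference of the two sides of the next inequality,
    the covariance of a two-point distribution.\<close>
  then have "p * (1 - p) * ((?a - ?b) * (?c - ?d)) \<ge> 0"
    using p by (intro mult_nonneg_nonneg) auto
  then have "((1 - p) * ?a + p * ?b) * ((1 - p) * ?c + p * ?d) \<le> (1 - p) * (?a * ?c) + p * (?b * ?d)"
    by (simp add: algebra_simps)
  ultimately show ?case unfolding expect_insert[OF insert.hyps] by linarith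
qed

lemma expect_superset:
  assumes "finite I" and "F \<subseteq> I"
  shows "expect p I (\<lambda>S. of_bool (F \<subseteq> S)) = p ^ card F"
  using assms
proof (induction I arbitrary: F rule: finite_induct)
  case empty
  then show ?case by (simp add: expect_def weight_def)
next
  case (insert i I)
  show ?case
  proof (cases "i \<in> F")
    case True
    have "finite F" using insert by (auto intro: finite_subset)
    have "expect p I (\<lambda>S. of_bool (F \<subseteq> S)) = expect p I (\<lambda>S. 0)"
      using True insert.hyps by (intro expect_cong) auto
    moreover have "expect p I (\<lambda>S. of_bool (F \<subseteq> insert i S)) = expect p I (\<lambda>S. of_bool (F - {i} \<subseteq> S))"
      by (intro expect_cong) auto
    moreover have "\<dots> = p ^ card (F - {i})" using insert.prems by (intro insert.IH) auto
    moreover have "card F = Suc (card (F - {i}))" using True \<open>finite F\<close> by (metis card.remove)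
    ultimately show ?thesis
      unfolding expect_insert[OF insert.hyps] by (simp add: expect_def)
  next
    case False
    then have "expect p I (\<lambda>S. of_bool (F \<subseteq> insert i S)) = expect p I (\<lambda>S. of_bool (F \<subseteq> S))"
      by (intro expect_cong) auto
    then show ?thesis unfolding expect_insert[OF insert.hyps]
      using insert.IH[of F] insert.prems False by (auto simp: algebra_simps)
  qed
qed

lemma expect_one: "finite I \<Longrightarrow> expect p I (\<lambda>S. 1) = 1"
  using expect_superset[of I "{}" p] by simp

lemma expect_not_superset:
  "finite I \<Longrightarrow> F \<subseteq> I \<Longrightarrow> expect p I (\<lambda>S. of_bool (\<not> F \<subseteq> S)) = 1 - p ^ card F"
  using expect_linear(2)[of p I "\<lambda>_. 1" "\<lambda>S. of_bool (F \<subseteq> S)"]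
  by (simp add: expect_superset expect_one of_bool_not_iff)

text \<open>Avoiding a fixed set is a decreasing event, so Harris' inequality bounds the joint
  probability below by the product, one set at a time.\<close>

lemma expect_avoid_ge:
  assumes "finite I" and p: "0 \<le> p" "p \<le> 1" and "finite \<F>" and "\<And>F. F \<in> \<F> \<Longrightarrow> F \<subseteq> I"
  shows "expect p I (\<lambda>S. of_bool (\<forall>F\<in>\<F>. \<not> F \<subseteq> S)) \<ge> (\<Prod>F\<in>\<F>. 1 - p ^ card F)"
  using assms(4,5)
proof (induction \<F> rule: finite_induct)
  case empty
  show ?case using assms(1) by (simp add: expect_one)
next
  case (insert F \<F>)
  have "(\<Prod>F\<in>insert F \<F>. 1 - p ^ card F) = (1 - p ^ card F) * (\<Prod>F\<in>\<F>. 1 - p ^ card F)"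
    using insert.hyps by simp
  also have "\<dots> \<le> (1 - p ^ card F) * expect p I (\<lambda>S. of_bool (\<forall>F\<in>\<F>. \<not> F \<subseteq> S))"
    using insert p by (intro mult_left_mono) (auto simp: power_le_one)
  also have "1 - p ^ card F = expect p I (\<lambda>S. of_bool (\<not> F \<subseteq> S))"
    using insert.prems assms(1) by (simp add: expect_not_superset)
  also have "expect p I (\<lambda>S. of_bool (\<not> F \<subseteq> S)) * expect p I (\<lambda>S. of_bool (\<forall>F\<in>\<F>. \<not> F \<subseteq> S)) \<le>
    expect p I (\<lambda>S. of_bool (\<not> F \<subseteq> S) * of_bool (\<forall>F\<in>\<F>. \<not> F \<subseteq> S))"
    by (intro expect_harris assms(1) p) (auto simp: of_bool_def dest: order_trans)
  also have "\<dots> = expect p I (\<lambda>S. of_bool (\<forall>F\<in>insert F \<F>. \<not> F \<subseteq> S))"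
    by (intro expect_cong) auto
  finally show ?case .
qed

lemma one_minus_ge_exp:
  fixes x :: real
  assumes "0 \<le> x" and "x \<le> 1 / 2"
  shows "exp (- 2 * x) \<le> 1 - x"
proof -
  have "- x - 2 * x\<^sup>2 \<le> ln (1 - x)" using assms by (rule ln_one_minus_pos_lower_bound)
  moreover have "x\<^sup>2 \<le> x / 2" using assms by (auto simp: power2_eq_square intro!: mult_left_mono[of x "1/2" x, simplified])
  ultimately have "- 2 * x \<le> ln (1 - x)" by simp
  then show ?thesis using assms by (subst (asm) ln_ge_iff) auto
qed

lemma expect_avoid_ge_exp:
  assumes "finite I" and p: "0 \<le> p" "p \<le> 1 / 2" and "finite \<F>" 
    and \<F>: "\<And>F. F \<in> \<F> \<Longrightarrow> F \<subseteq> I" "{} \<notin> \<F>"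
    and K: "(\<Sum>F\<in>\<F>. p ^ card F) \<le> K"
  shows "expect p I (\<lambda>S. of_bool (\<forall>F\<in>\<F>. \<not> F \<subseteq> S)) \<ge> exp (- 2 * K)"
proof -
  \<comment> \<open>Excluding the empty set makes each term at most \<open>p\<close>, the range in
    which \<open>1 - x\<close> dominates \<open>exp (- 2 * x)\<close>.\<close>
  have le: "p ^ card F \<le> 1 / 2" if "F \<in> \<F>" for F
  proof -
    have "card F \<ge> 1" using that \<F> assms(1) by (metis One_nat_def Suc_leI card_gt_0_iff finite_subset)
    then have "p ^ card F \<le> p ^ 1" using p by (intro power_decreasing) auto
    then show ?thesis using p by simp
  qed
  have "exp (- 2 * K) \<le> exp (\<Sum>F\<in>\<F>. - 2 * p ^ card F)"
    using K unfolding sum_distrib_left[symmetric] by simp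
  also have "\<dots> = (\<Prod>F\<in>\<F>. exp (- 2 * p ^ card F))" using assms(4) by (rule exp_sum)
  also have "\<dots> \<le> (\<Prod>F\<in>\<F>. 1 - p ^ card F)"
    using p le by (intro prod_mono conjI one_minus_ge_exp) auto
  also have "\<dots> \<le> expect p I (\<lambda>S. of_bool (\<forall>F\<in>\<F>. \<not> F \<subseteq> S))"
    using assms by (intro expect_avoid_ge) auto
  finally show ?thesis .
qed

text \<open>With \<open>X\<close> the number of members of \<open>\<B>\<close> present,
  \<open>2 * r * X - r^2 * X^2\<close> is 0 when \<open>X = 0\<close> and at most 1 always, because
  \<open>(1 - r * X)^2\<close> is nonnegative. The parameter \<open>r\<close> is left free and
  optimised later.\<close>

lemma expect_second_moment:
  assumes "finite I" and p: "0 \<le> p" "p \<le> 1" and "finite \<B>" and \<B>: "\<And>F. F \<in> \<B> \<Longrightarrow> F \<subseteq> I"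
  shows "expect p I (\<lambda>S. of_bool (\<exists>F\<in>\<B>. F \<subseteq> S)) \<ge>
    2 * r * (\<Sum>F\<in>\<B>. p ^ card F) - r\<^sup>2 * (\<Sum>F\<in>\<B>. \<Sum>F'\<in>\<B>. p ^ card (F \<union> F'))"
proof -
  define X :: "'a set \<Rightarrow> real" where "X S = (\<Sum>F\<in>\<B>. of_bool (F \<subseteq> S))" for S
  have EX: "expect p I X = (\<Sum>F\<in>\<B>. p ^ card F)"
    unfolding X_def expect_linear using \<B> assms(1) by (intro sum.cong refl expect_superset) auto
  have "expect p I (\<lambda>S. (X S)\<^sup>2) = expect p I (\<lambda>S. \<Sum>F\<in>\<B>. \<Sum>F'\<in>\<B>. of_bool (F \<union> F' \<subseteq> S))"
    unfolding X_def power2_eq_square sum_product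
    by (intro expect_cong sum.cong refl) (simp flip: of_bool_conj)
  also have "\<dots> = (\<Sum>F\<in>\<B>. \<Sum>F'\<in>\<B>. p ^ card (F \<union> F'))"
    unfolding expect_linear using \<B> assms(1) by (intro sum.cong refl expect_superset) auto
  finally have EX2: "expect p I (\<lambda>S. (X S)\<^sup>2) = (\<Sum>F\<in>\<B>. \<Sum>F'\<in>\<B>. p ^ card (F \<union> F'))" .
  have "expect p I (\<lambda>S. 2 * r * X S - r\<^sup>2 * (X S)\<^sup>2) \<le> expect p I (\<lambda>S. of_bool (\<exists>F\<in>\<B>. F \<subseteq> S))"
  proof (intro expect_mono p)
    fix S
    show "2 * r * X S - r\<^sup>2 * (X S)\<^sup>2 \<le> of_bool (\<exists>F\<in>\<B>. F \<subseteq> S)"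
    proof (cases "\<exists>F\<in>\<B>. F \<subseteq> S")
      case True
      have "(1 - r * X S)\<^sup>2 \<ge> 0" by simp
      then show ?thesis using True by (simp add: power2_eq_square algebra_simps)
    next
      case False
      then have "X S = 0" by (simp add: X_def)
      then show ?thesis by simp
    qed
  qed
  then show ?thesis by (simp add: expect_linear EX EX2 mult.assoc)
qed

text \<open>Ordered pairs are split into equal, disjoint and overlapping ones. The first two kinds
  give the mean and its square; overlapping pairs are grouped by their union \<open>U\<close>, which
  contains at most \<open>2 ^ card U\<close> members of \<open>\<B>\<close> and hence at most
  \<open>4 ^ card U\<close> pairs.\<close>

lemma sum_pairs_le:
  fixes p :: real
  assumes p: "0 \<le> p" and "finite \<B>" and fin: "\<And>F. F \<in> \<B> \<Longrightarrow> finite F"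
    and "finite \<U>" and \<U>: "\<And>U. U \<in> \<U> \<Longrightarrow> finite U"
    and overlap: "\<And>F F'. F \<in> \<B> \<Longrightarrow> F' \<in> \<B> \<Longrightarrow> F \<noteq> F' \<Longrightarrow> F \<inter> F' \<noteq> {} \<Longrightarrow> F \<union> F' \<in> \<U>"
  shows "(\<Sum>F\<in>\<B>. \<Sum>F'\<in>\<B>. p ^ card (F \<union> F')) \<le>
    (\<Sum>F\<in>\<B>. p ^ card F) + (\<Sum>F\<in>\<B>. p ^ card F)\<^sup>2 + (\<Sum>U\<in>\<U>. 4 ^ card U * p ^ card U)"
proof -
  have le: "p ^ card (F \<union> F') \<le> (if F = F' then p ^ card F else 0) + p ^ card F * p ^ card F' +
      (\<Sum>U\<in>\<U>. of_bool (F \<subseteq> U) * of_bool (F' \<subseteq> U) * p ^ card U)" (is "_ \<le> ?a + ?b + ?c")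
    if F: "F \<in> \<B>" "F' \<in> \<B>" for F F'
  proof -
    have nn: "?a \<ge> 0" "?b \<ge> 0" "?c \<ge> 0" using p by (auto intro!: sum_nonneg)
    consider "F = F'" | "F \<inter> F' = {}" | "F \<noteq> F'" "F \<inter> F' \<noteq> {}" by blast
    then show ?thesis
    proof cases
      case 1
      then have "p ^ card (F \<union> F') = ?a" by simp
      then show ?thesis using nn by linarith
    next
      case 2
      then have "p ^ card (F \<union> F') = ?b" using F fin by (simp add: card_Un_disjoint power_add)
      then show ?thesis using nn by linarith
    next
      case 3
      then have "F \<union> F' \<in> \<U>" using F overlap by blast
      then have "of_bool (F \<subseteq> F \<union> F') * of_bool (F' \<subseteq> F \<union> F') * p ^ card (F \<union> F') \<le> ?c"
        using p assms(4) by (intro member_le_sum) auto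
      then show ?thesis using nn by simp
    qed
  qed
  have c: "(\<Sum>F\<in>\<B>. \<Sum>F'\<in>\<B>. of_bool (F \<subseteq> U) * of_bool (F' \<subseteq> U) * p ^ card U) \<le> 4 ^ card U * p ^ card U"
    if "U \<in> \<U>" for U
  proof -
    have "(\<Sum>F\<in>\<B>. of_bool (F \<subseteq> U)) = real (card (\<B> \<inter> Pow U))"
      using assms(2) by (simp add: of_bool_def sum.If_cases Int_def Pow_def)
    also have "\<dots> \<le> 2 ^ card U"
      using card_mono[of "Pow U" "\<B> \<inter> Pow U"] \<U>[OF that]
      by (simp add: card_Pow flip: of_nat_power)
    finally have "(\<Sum>F\<in>\<B>. of_bool (F \<subseteq> U)) * (\<Sum>F\<in>\<B>. of_bool (F \<subseteq> U)) \<le> (2 ^ card U * 2 ^ card U :: real)"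
      by (intro mult_mono) (auto intro!: sum_nonneg)
    also have "\<dots> = 4 ^ card U" by (simp flip: power_mult_distrib)
    finally have "(\<Sum>F\<in>\<B>. of_bool (F \<subseteq> U)) * (\<Sum>F\<in>\<B>. of_bool (F \<subseteq> U)) * p ^ card U \<le> 4 ^ card U * p ^ card U"
      using p by (intro mult_right_mono) auto
    then show ?thesis unfolding sum_product by (simp only: sum_distrib_right)
  qed
  have "(\<Sum>F\<in>\<B>. \<Sum>F'\<in>\<B>. p ^ card (F \<union> F')) \<le>
    (\<Sum>F\<in>\<B>. \<Sum>F'\<in>\<B>. (if F = F' then p ^ card F else 0) + p ^ card F * p ^ card F' +
      (\<Sum>U\<in>\<U>. of_bool (F \<subseteq> U) * of_bool (F' \<subseteq> U) * p ^ card U))"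
    by (intro sum_mono le)
  also have "\<dots> = (\<Sum>F\<in>\<B>. p ^ card F) + (\<Sum>F\<in>\<B>. p ^ card F)\<^sup>2 +
      (\<Sum>F\<in>\<B>. \<Sum>F'\<in>\<B>. \<Sum>U\<in>\<U>. of_bool (F \<subseteq> U) * of_bool (F' \<subseteq> U) * p ^ card U)"
    using assms(2) by (simp add: sum.distrib power2_eq_square sum_product sum.delta)
  also have "(\<Sum>F\<in>\<B>. \<Sum>F'\<in>\<B>. \<Sum>U\<in>\<U>. of_bool (F \<subseteq> U) * of_bool (F' \<subseteq> U) * p ^ card U) =
    (\<Sum>U\<in>\<U>. \<Sum>F\<in>\<B>. \<Sum>F'\<in>\<B>. of_bool (F \<subseteq> U) * of_bool (F' \<subseteq> U) * p ^ card U)"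
  proof -
    have "(\<Sum>F'\<in>\<B>. \<Sum>U\<in>\<U>. of_bool (F \<subseteq> U) * of_bool (F' \<subseteq> U) * p ^ card U) =
      (\<Sum>U\<in>\<U>. \<Sum>F'\<in>\<B>. of_bool (F \<subseteq> U) * of_bool (F' \<subseteq> U) * p ^ card U)" for F
      by (rule sum.swap)
    then show ?thesis by (simp only:) (rule sum.swap)
  qed
  also have "\<dots> \<le> (\<Sum>U\<in>\<U>. 4 ^ card U * p ^ card U)" by (intro sum_mono c)
  finally show ?thesis by simp
qed

section \<open>The random hypergraph and the expected number of dense edge sets\<close>

lemma finite_possible_edges: "finite (possible_edges s n)"
  unfolding possible_edges_def by (rule finite_subset[of _ "Pow {1..n}"]) auto

lemma prob_random_hypergraph:
  assumes p: "0 \<le> p" "p \<le> 1"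
  shows "measure_pmf.prob (random_hypergraph s n p) A = expect p (possible_edges s n) (\<lambda>S. of_bool (S \<in> A))"
proof -
  define I where "I = possible_edges s n"
  have "finite I" unfolding I_def by (rule finite_possible_edges)
  define M where "M = Pi_pmf I False (\<lambda>_. bernoulli_pmf p)"
  define h where "h S = (\<lambda>e. e \<in> S)" for S :: "nat set set"
  let ?f = "\<lambda>present. {e \<in> I. present e}"
  have pmf: "pmf M (h S) = weight p I S" if "S \<subseteq> I" for S
  proof -
    have "pmf M (h S) = (\<Prod>e\<in>I. pmf (bernoulli_pmf p) (h S e))"
      unfolding M_def using \<open>finite I\<close> that by (intro pmf_Pi') (auto simp: h_def)
    also have "\<dots> = (\<Prod>e\<in>I. if e \<in> S then p else 1 - p)"
      using p by (intro prod.cong) (auto simp: h_def)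
    also have "\<dots> = weight p I S"
      using \<open>finite I\<close> that by (simp add: prod.If_cases weight_def Int_absorb1 Diff_eq)
    finally show ?thesis .
  qed
  \<comment> \<open>Outside \<open>I\<close> the product takes the default value
    \<open>False\<close>, so its support consists of characteristic functions of subsets of
    \<open>I\<close>.\<close>
  have sub: "set_pmf M \<subseteq> h ` Pow I"
  proof
    fix x assume "x \<in> set_pmf M"
    then have "x \<in> PiE_dflt I False (\<lambda>_. set_pmf (bernoulli_pmf p))"
      using set_Pi_pmf_subset'[OF \<open>finite I\<close>, of False "\<lambda>_. bernoulli_pmf p"] unfolding M_def o_def
      by blast
    then have "x = h {e \<in> I. x e}" by (auto simp: PiE_dflt_def h_def fun_eq_iff)
    then show "x \<in> h ` Pow I" by blast
  qed
  have inj: "inj_on h (Pow I)" by (auto simp: inj_on_def h_def fun_eq_iff)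
  have "measure_pmf.prob (random_hypergraph s n p) A = measure_pmf.prob M (?f -` A)"
    unfolding random_hypergraph_def I_def[symmetric] M_def[symmetric] by simp
  also have "\<dots> = measure_pmf.prob M (?f -` A \<inter> h ` Pow I)"
    using sub by (intro measure_pmf.finite_measure_eq_AE) (auto simp: AE_measure_pmf_iff)
  also have "\<dots> = (\<Sum>x\<in>?f -` A \<inter> h ` Pow I. pmf M x)"
    using \<open>finite I\<close> by (intro measure_measure_pmf_finite) auto
  also have "?f -` A \<inter> h ` Pow I = h ` (Pow I \<inter> A)"
  proof -
    have "?f (h S) = S" if "S \<subseteq> I" for S using that by (auto simp: h_def)
    then show ?thesis by auto
  qed
  also have "(\<Sum>x\<in>h ` (Pow I \<inter> A). pmf M x) = (\<Sum>S\<in>Pow I \<inter> A. pmf M (h S))"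
    using inj by (subst sum.reindex) (auto intro: inj_on_subset)
  also have "\<dots> = (\<Sum>S\<in>Pow I \<inter> A. weight p I S)" by (intro sum.cong) (auto simp: pmf)
  also have "\<dots> = expect p I (\<lambda>S. of_bool (S \<in> A))"
    unfolding expect_def using \<open>finite I\<close> by (intro sum.mono_neutral_cong_left) auto
  finally show ?thesis unfolding I_def .
qed

text \<open>Such a family is encoded by a map of \<open>{..<v}\<close> onto its span together with a
  family of subsets of \<open>{..<v}\<close>; the bound counts these codes.\<close>

lemma card_bounded_span_le:
  assumes "v \<ge> 1"
  shows "finite {F. \<Union>F \<subseteq> {1..n::nat} \<and> \<Union>F \<noteq> {} \<and> card (\<Union>F) \<le> v}" (is "finite ?A")
    and "card {F. \<Union>F \<subseteq> {1..n::nat} \<and> \<Union>F \<noteq> {} \<and> card (\<Union>F) \<le> v} \<le> n ^ v * 2 ^ 2 ^ v"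
proof -
  let ?D = "(({..<v} \<rightarrow>\<^sub>E {1..n}) \<times> Pow (Pow {..<v}))"
  let ?h = "\<lambda>(g, \<A>). (\<lambda>A. g ` A) ` \<A>"
  have sub: "?A \<subseteq> ?h ` ?D"
  proof
    fix F assume "F \<in> ?A"
    then have F: "\<Union>F \<subseteq> {1..n}" "\<Union>F \<noteq> {}" "card (\<Union>F) \<le> v" by auto
    have "finite (\<Union>F)" using F finite_subset by blast
    then obtain g0 where g0: "bij_betw g0 {..<card (\<Union>F)} (\<Union>F)"
      using ex_bij_betw_nat_finite atLeast0LessThan by metis
    obtain w where w: "w \<in> \<Union>F" using F by blast
    \<comment> \<open>The span may have fewer than \<open>v\<close> vertices; surplus indices are
      sent to a fixed vertex \<open>w\<close> of it.\<close>
    define g where "g = restrict (\<lambda>i. if i < card (\<Union>F) then g0 i else w) {..<v}"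
    have im: "g ` {..<v} = \<Union>F"
    proof
      show "g ` {..<v} \<subseteq> \<Union>F" using g0 w by (auto simp: g_def bij_betw_def)
      show "\<Union>F \<subseteq> g ` {..<v}"
      proof
        fix x assume "x \<in> \<Union>F"
        then obtain i where "i < card (\<Union>F)" "x = g0 i" using g0 by (auto simp: bij_betw_def)
        then show "x \<in> g ` {..<v}" using F(3) by (intro image_eqI[of _ _ i]) (auto simp: g_def)
      qed
    qed
    have "g ` {..<v} \<subseteq> {1..n}" using im F(1) by (simp only:)
    moreover have "g \<in> extensional {..<v}" by (simp add: g_def)
    ultimately have "g \<in> {..<v} \<rightarrow>\<^sub>E {1..n}" unfolding PiE_def image_subset_iff_funcset by blast
    moreover have "F = (\<lambda>A. g ` A) ` {A. A \<subseteq> {..<v} \<and> g ` A \<in> F}"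
    proof
      show "F \<subseteq> (\<lambda>A. g ` A) ` {A. A \<subseteq> {..<v} \<and> g ` A \<in> F}"
      proof
        fix e assume e: "e \<in> F"
        then have "e \<subseteq> g ` {..<v}" using im by blast
        then have "g ` {i\<in>{..<v}. g i \<in> e} = e" by blast
        then show "e \<in> (\<lambda>A. g ` A) ` {A. A \<subseteq> {..<v} \<and> g ` A \<in> F}"
          using e by (intro image_eqI[of _ _ "{i\<in>{..<v}. g i \<in> e}"]) auto
      qed
    qed auto
    ultimately show "F \<in> ?h ` ?D"
      by (intro image_eqI[of _ _ "(g, {A. A \<subseteq> {..<v} \<and> g ` A \<in> F})"]) auto
  qed
  have fin: "finite ?D" by (intro finite_cartesian_product finite_PiE) auto
  then show "finite ?A" using sub by (rule finite_surj)
  have "card ?A \<le> card ?D" using surj_card_le[OF fin sub] .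
  also have "\<dots> = n ^ v * 2 ^ 2 ^ v" by (simp add: card_cartesian_product card_PiE card_Pow)
  finally show "card ?A \<le> n ^ v * 2 ^ 2 ^ v" .
qed

text \<open>Used with \<open>j = 1\<close>, \<open>b = m\<close> for the sets to be avoided and with
  \<open>j = 2\<close>, \<open>b = 2 * m\<close> for unions of overlapping copies. Both have
  \<open>b = j * m\<close>, up to which the expected number stays bounded.\<close>

definition dense_sets :: "nat \<Rightarrow> nat \<Rightarrow> nat \<Rightarrow> nat \<Rightarrow> nat set set set" where
  "dense_sets s n j b = {F. F \<subseteq> possible_edges s n \<and> F \<noteq> {} \<and> card F \<le> b \<and> excess s F \<ge> int j}"

lemma finite_dense_sets: "finite (dense_sets s n j b)"
  unfolding dense_sets_def
  by (rule finite_subset[of _ "Pow (possible_edges s n)"]) (auto simp: finite_possible_edges)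

lemma uniform_possible_edges:
  assumes "F \<subseteq> possible_edges s n"
  shows "uniform s F"
proof -
  have "finite F" using assms finite_possible_edges by (rule finite_subset)
  moreover have "finite e \<and> card e = s" if "e \<in> possible_edges s n" for e
    using that finite_subset[of e "{1..n}"] by (simp add: possible_edges_def)
  ultimately show ?thesis using assms unfolding uniform_def by blast
qed

text \<open>Sets of \<open>f\<close> edges and excess at least \<open>j\<close> span at most
  \<open>v = (s - 1) * f - j\<close> vertices, so their number is of order at most
  \<open>n ^ v\<close>. Multiplying by \<open>p ^ f\<close> leaves
  \<open>n powr (f / m - j)\<close>, which is at most 1 for \<open>f \<le> j * m\<close>.\<close>

lemma sum_dense_sets_bounded:
  assumes "s \<ge> 1" and "m \<ge> 1" and "n \<ge> 1" and \<alpha>: "\<alpha> = real s - 1 - 1 / real m"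
  shows "(\<Sum>F\<in>dense_sets s n j (j * m). (real n powr - \<alpha>) ^ card F) \<le>
    (\<Sum>f\<le>j * m. 2 ^ 2 ^ ((s - 1) * f))"
proof -
  define p where "p = real n powr - \<alpha>"
  have "p > 0" using assms by (simp add: p_def)
  let ?S = "dense_sets s n j (j * m)"
  have "(\<Sum>F\<in>?S. p ^ card F) = (\<Sum>f\<le>j * m. \<Sum>F\<in>{F\<in>?S. card F = f}. p ^ card F)"
    by (intro sum.group[symmetric] finite_dense_sets) (auto simp: dense_sets_def)
  also have "\<dots> \<le> (\<Sum>f\<le>j * m. 2 ^ 2 ^ ((s - 1) * f))"
  proof (intro sum_mono)
    fix f assume "f \<in> {..j * m}"
    show "(\<Sum>F\<in>{F\<in>?S. card F = f}. p ^ card F) \<le> 2 ^ 2 ^ ((s - 1) * f)"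
    proof (cases "{F\<in>?S. card F = f} = {}")
      case False
      define v where "v = (s - 1) * f - j"
      have span: "\<Union>F \<subseteq> {1..n} \<and> \<Union>F \<noteq> {} \<and> card (\<Union>F) + j \<le> (s - 1) * f"
        if "F \<in> ?S" "card F = f" for F
      proof -
        have F: "F \<subseteq> possible_edges s n" "F \<noteq> {}" "excess s F \<ge> j"
          using that by (auto simp: dense_sets_def)
        have "\<Union>F \<noteq> {}" using F assms(1) by (force simp: possible_edges_def)
        moreover have "int (card (\<Union>F)) + j \<le> (int s - 1) * f"
          using F(3) that(2) by (simp add: excess_def)
        then have "int (card (\<Union>F) + j) \<le> int ((s - 1) * f)" using assms(1) by (simp add: of_nat_diff)
        moreover have "\<Union>F \<subseteq> {1..n}" using F by (auto simp: possible_edges_def)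
        ultimately show ?thesis by linarith
      qed
      \<comment> \<open>A member of the class shows that the truncated subtraction in
        \<open>v\<close> is a true one and that \<open>v\<close> is positive; an empty class
        contributes 0.\<close>
      obtain F0 where F0: "F0 \<in> ?S" "card F0 = f" using False by blast
      have "card (\<Union>F0) \<ge> 1" using span[OF F0]
        by (metis One_nat_def Suc_leI card_gt_0_iff finite_atLeastAtMost finite_subset)
      then have v: "v \<ge> 1" "v + j = (s - 1) * f" using span[OF F0] by (auto simp: v_def)
      have "{F\<in>?S. card F = f} \<subseteq> {F. \<Union>F \<subseteq> {1..n} \<and> \<Union>F \<noteq> {} \<and> card (\<Union>F) \<le> v}"
        using span v(2) by fastforce
      then have "card {F\<in>?S. card F = f} \<le> n ^ v * 2 ^ 2 ^ v"
        using card_mono card_bounded_span_le[OF v(1), of n] order_trans by blast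
      then have "real (card {F\<in>?S. card F = f}) \<le> real (n ^ v * 2 ^ 2 ^ v)" by (rule of_nat_mono)
      then have "(\<Sum>F\<in>{F\<in>?S. card F = f}. p ^ card F) \<le> real (n ^ v * 2 ^ 2 ^ v) * p ^ f"
        using \<open>p > 0\<close> by (simp add: mult_right_mono)
      also have "\<dots> = 2 ^ 2 ^ v * (real n ^ v * p ^ f)" by simp
      also have "real n ^ v * p ^ f = real n powr (real f / real m - real j)"
      proof -
        have "real n ^ v * p ^ f = real n powr (real v - \<alpha> * real f)"
          using assms(3) by (simp add: p_def powr_realpow[symmetric] powr_powr powr_add[symmetric])
        also have "real v = (real s - 1) * real f - real j"
        proof -
          have "real (v + j) = real ((s - 1) * f)" using v(2) by simp
          then show ?thesis using assms(1) by (simp add: of_nat_diff)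
        qed
        finally show ?thesis by (simp add: \<alpha> algebra_simps)
      qed
      also have "\<dots> \<le> real n powr 0"
      proof (intro powr_mono)
        have "real f \<le> real j * real m" using \<open>f \<in> {..j * m}\<close> by (simp flip: of_nat_mult)
        then show "real f / real m - real j \<le> 0" using assms(2) by (simp add: field_simps)
      qed (use assms in auto)
      also have "\<dots> = 1" using assms by simp
      finally have "(\<Sum>F\<in>{F\<in>?S. card F = f}. p ^ card F) \<le> 2 ^ 2 ^ v" by simp
      also have "(2 :: real) ^ 2 ^ v \<le> 2 ^ 2 ^ ((s - 1) * f)"
        by (intro power_increasing) (auto simp: v_def)
      finally show ?thesis .
    next
      case True
      then show ?thesis by (simp only: sum.empty) simp
    qed
  qed
  finally show ?thesis unfolding p_def .
qed

section \<open>The extremal dumbbell\<close>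

text \<open>
  Double counting: a vertex of \<open>B\<close> lying on no edge of \<open>A\<close> is counted twice by the removed
  edges, either as a private vertex of weight 2 or as a shared vertex of weight 1. Every removed edge has
  total weight at most \<open>2 (s - 1)\<close>, with strict inequality for an edge touching \<open>A\<close>.
\<close>

lemma excess_proper_subset_less:
  assumes B: "uniform s B" and A: "A \<subseteq> B" "A \<noteq> B"
    and shared: "\<And>e. e \<in> B \<Longrightarrow> card {v \<in> e. \<exists>f\<in>B. f \<noteq> e \<and> v \<in> f} \<ge> 2"
    and touch: "\<Union>A \<inter> \<Union>(B - A) \<noteq> {}"
  shows "excess s A < excess s B"
proof -
  define R where "R = B - A"
  define D where "D = \<Union>B - \<Union>A"
  define c :: "'a \<Rightarrow> nat" where "c v = (if \<exists>e\<in>B. \<exists>f\<in>B. e \<noteq> f \<and> v \<in> e \<and> v \<in> f then 1 else 2)" for v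
  have fin: "finite B" "finite A" "finite R" "finite (\<Union>B)" "finite D"
    using B A by (auto simp: R_def D_def intro: uniform_finite uniform_finite_Union finite_subset simp del: finite_Union)
  have e: "finite e" "card e = s" if "e \<in> B" for e using that B by (auto simp: uniform_def)
  have edge: "(\<Sum>v\<in>e. c v) \<le> 2 * (s - 1)" if "e \<in> B" for e
  proof -
    let ?S = "{v \<in> e. \<exists>f\<in>B. f \<noteq> e \<and> v \<in> f}"
    have "(\<Sum>v\<in>e. c v) = (\<Sum>v\<in>e - ?S. c v) + (\<Sum>v\<in>?S. c v)"
      using e[OF that] by (intro sum.subset_diff) auto
    also have "(\<Sum>v\<in>e - ?S. c v) = (\<Sum>v\<in>e - ?S. 2)"
      using that by (intro sum.cong refl) (auto simp: c_def)
    also have "(\<Sum>v\<in>?S. c v) = (\<Sum>v\<in>?S. 1)"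
      using that by (intro sum.cong refl) (auto simp: c_def)
    also have "(\<Sum>v\<in>e - ?S. 2) + (\<Sum>v\<in>?S. 1) = card ?S + 2 * card (e - ?S)" by simp
    also have "card (e - ?S) = s - card ?S" using e[OF that] by (subst card_Diff_subset) auto
    also have "card ?S + 2 * (s - card ?S) \<le> 2 * (s - 1)"
      using shared[OF that] card_mono[of e ?S] e[OF that] by auto
    finally show ?thesis .
  qed
  have "2 * card D = (\<Sum>v\<in>D. 2)" by simp
  also have "\<dots> \<le> (\<Sum>v\<in>D. \<Sum>r\<in>{r\<in>R. v \<in> r}. c v)"
  proof (intro sum_mono)
    fix v assume v: "v \<in> D"
    then have all: "r \<in> R" if "r \<in> B" "v \<in> r" for r using that by (auto simp: R_def D_def)
    obtain r where r: "r \<in> B" "v \<in> r" using v by (auto simp: D_def)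
    have fr: "finite {r\<in>R. v \<in> r}" using fin by simp
    show "2 \<le> (\<Sum>r\<in>{r\<in>R. v \<in> r}. c v)"
    proof (cases "\<exists>e\<in>B. \<exists>f\<in>B. e \<noteq> f \<and> v \<in> e \<and> v \<in> f")
      case True
      then obtain e f where "e \<in> B" "f \<in> B" "e \<noteq> f" "v \<in> e" "v \<in> f" by blast
      then have "card {e, f} \<le> card {r\<in>R. v \<in> r}" using all fr by (intro card_mono) auto
      then show ?thesis using True \<open>e \<noteq> f\<close> by (simp add: c_def)
    next
      case False
      have "card {r} \<le> card {r\<in>R. v \<in> r}" using all r fr by (intro card_mono) auto
      moreover have "c v = 2" using False unfolding c_def by (rule if_not_P)
      ultimately show ?thesis by simp
    qed
  qed
  also have "\<dots> = (\<Sum>r\<in>R. \<Sum>v\<in>{v\<in>D. v \<in> r}. c v)"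
    by (rule sum.swap_restrict[OF fin(5,3)])
  also have "\<dots> < (\<Sum>r\<in>R. 2 * (s - 1))"
  proof (rule sum_strict_mono_ex1[OF fin(3)])
    have le: "(\<Sum>v\<in>{v\<in>D. v \<in> r}. c v) \<le> (\<Sum>v\<in>r. c v)" if "r \<in> R" for r
      using that e by (intro sum_mono2) (auto simp: R_def)
    then show "\<forall>r\<in>R. (\<Sum>v\<in>{v\<in>D. v \<in> r}. c v) \<le> 2 * (s - 1)"
    proof (intro ballI order_trans[OF le edge])
      show "r \<in> B" if "r \<in> R" for r using that by (simp add: R_def)
    qed
    obtain v r where v: "v \<in> \<Union>A" "v \<in> r" "r \<in> R" using touch by (auto simp: R_def)
    \<comment> \<open>The vertex \<open>v\<close> of \<open>A\<close> lies in \<open>r\<close> but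
      outside \<open>D\<close>, so the restricted sum drops its positive weight.\<close>
    have "(\<Sum>v\<in>{v\<in>D. v \<in> r}. c v) < (\<Sum>v\<in>r. c v)"
      using v e[of r] by (intro sum_strict_mono2[of _ _ v]) (auto simp: R_def D_def c_def)
    then show "\<exists>r\<in>R. (\<Sum>v\<in>{v\<in>D. v \<in> r}. c v) < 2 * (s - 1)"
      using edge[of r] v by (intro bexI[of _ r]) (auto simp: R_def)
  qed
  finally have D: "card D < (s - 1) * card R" by (simp add: mult.commute)
  have "s \<ge> 1" using D by (cases s) auto
  have "card B = card A + card R"
    using A fin by (simp add: R_def card_Diff_subset card_mono)
  moreover have "card (\<Union>B) = card (\<Union>A) + card D"
  proof -
    have "\<Union>A \<subseteq> \<Union>B" using A by blast
    then show ?thesis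
      using fin by (simp add: D_def card_Diff_subset finite_subset card_mono)
  qed
  moreover have "int (card D) < (int s - 1) * card R"
  proof -
    have "int (card D) < int ((s - 1) * card R)" using D by (simp only: of_nat_less_iff)
    then show ?thesis using \<open>s \<ge> 1\<close> by (simp add: of_nat_diff)
  qed
  ultimately show ?thesis by (simp add: excess_def algebra_simps)
qed

text \<open>
  The extremal hypergraph is a chain of \<open>m\<close> edges, consecutive ones sharing the vertices
  \<open>i * (s - 1)\<close>, with two extra identifications: the first two edges share a second vertex,
  and the last edge is closed up to the vertex \<open>j * (s - 1)\<close>.
\<close>

definition chain_edge :: "nat \<Rightarrow> nat \<Rightarrow> nat \<Rightarrow> nat \<Rightarrow> nat set" where
  "chain_edge s m j i =
     (if i = 0 then {1..s}
      else if i = m - 1 then insert (j * (s - 1)) {i * (s - 1)..<(i + 1) * (s - 1)}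
      else {i * (s - 1)..(i + 1) * (s - 1)})"

definition chain :: "nat \<Rightarrow> nat \<Rightarrow> nat \<Rightarrow> nat set set" where
  "chain s m j = chain_edge s m j ` {..<m}"

text \<open>Edges 0 and 1 form the double edge, edges 2 to \<open>j - 1\<close> the path, and edges
  \<open>j\<close> to \<open>m - 1\<close> the cycle, which has at least three edges. Successive
  link vertices are \<open>q = s - 1\<close> apart.\<close>

locale chain_graph =
  fixes s m j q :: nat
  assumes s: "s = q + 1" and q: "q \<ge> 2" and j: "j \<ge> 2" "j + 3 \<le> m"
begin

abbreviation ed where "ed \<equiv> chain_edge s m j"

lemma ed_0: "ed 0 = {1..q + 1}"
  and ed_last: "ed (m - 1) = insert (j * q) {(m - 1) * q..<m * q}"
  and ed_mid: "1 \<le> i \<Longrightarrow> i < m - 1 \<Longrightarrow> ed i = {i * q..(i + 1) * q}"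
  using j by (auto simp: chain_edge_def s)

lemma ed_cases:
  assumes "i < m"
  obtains "i = 0" | "1 \<le> i" "i < m - 1" | "i = m - 1"
  using assms by linarith

lemma link_less: "i < i' \<Longrightarrow> i * q + q \<le> i' * q"
  by (metis Suc_leI add.commute mult_Suc mult_le_mono1)

lemma last_pos: "(m - 1) * q + q = m * q" "j * q + 3 * q \<le> m * q" "2 * q \<le> j * q"
proof -
  show "(m - 1) * q + q = m * q" using j by (cases m) auto
  show "j * q + 3 * q \<le> m * q" using mult_le_mono1[OF j(2), of q] by (simp only: add_mult_distrib)
  show "2 * q \<le> j * q" using j(1) by (rule mult_le_mono1)
qed

lemma finite_card_ed: "i < m \<Longrightarrow> finite (ed i) \<and> card (ed i) = s"
proof (erule ed_cases)
  show "finite (ed i) \<and> card (ed i) = s" if "i = m - 1"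
  proof -
    have "j * q < (m - 1) * q" "m * q - (m - 1) * q = q" using last_pos q by linarith+
    then have "card (ed (m - 1)) = Suc q" unfolding ed_last by (subst card_insert_disjoint) auto
    then show ?thesis unfolding that using card_ge_0_finite[of "ed (m - 1)"] by (simp add: s)
  qed
  show "finite (ed i) \<and> card (ed i) = s" if "i = 0"
    unfolding that ed_0 by (simp add: s)
  show "finite (ed i) \<and> card (ed i) = s" if "1 \<le> i" "i < m - 1"
    unfolding ed_mid[OF that] by (simp add: s)
qed

lemma link_in: "1 \<le> i \<Longrightarrow> i < m \<Longrightarrow> i * q \<in> ed i" "1 \<le> i \<Longrightarrow> i < m \<Longrightarrow> i * q \<in> ed (i - 1)"
proof -
  assume i: "1 \<le> i" "i < m"
  show "i * q \<in> ed i"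
  proof (cases "i = m - 1")
    case True
    have "(m - 1) * q < m * q" using last_pos(1) q by linarith
    then have "(m - 1) * q \<in> {(m - 1) * q..<m * q}" by (simp only: atLeastLessThan_iff order_refl simp_thms)
    then show ?thesis unfolding True ed_last by (rule insertI2)
  qed (use i in \<open>simp add: ed_mid\<close>)
  show "i * q \<in> ed (i - 1)"
  proof (cases "i = 1")
    case True
    then show ?thesis using q by (simp add: ed_0)
  next
    case False
    then show ?thesis using i ed_mid[of "i - 1"] by (auto simp: diff_mult_distrib)
  qed
qed

text \<open>Of two edges, the later one has a vertex above all vertices of the earlier one. The
  correction for \<open>i = 0\<close> reflects that the first edge reaches \<open>q + 1\<close>
  instead of \<open>q\<close>.\<close>

lemma ed_inj: "inj_on ed {..<m}"
proof -
  have "ed i \<noteq> ed i'" if "i < i'" "i' < m" for i i'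
  proof -
    have upper: "v \<le> i * q + q + of_bool (i = 0)" if "v \<in> ed i" for v
      using that ed_cases[of i] \<open>i < i'\<close> \<open>i' < m\<close> by (cases "i = 0") (auto simp: ed_0 ed_mid)
    obtain v where "v \<in> ed i'" "v > i * q + q + of_bool (i = 0)"
    proof (cases "i' = m - 1")
      case True
      have "m * q - 1 \<in> ed i'" unfolding True ed_last using last_pos q by auto
      moreover have "m * q - 1 > i * q + q + of_bool (i = 0)"
        using link_less[OF \<open>i < i'\<close>] True last_pos q by (auto simp: of_bool_def)
      ultimately show ?thesis using that by blast
    next
      case False
      then have "i' * q + q \<in> ed i'" using that \<open>i < i'\<close> \<open>i' < m\<close> by (subst ed_mid) auto
      moreover have "i' * q + q > i * q + q + of_bool (i = 0)"
      proof -
        have "(of_bool (i = 0) :: nat) < q" using q by simp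
        then show ?thesis using link_less[OF \<open>i < i'\<close>] by linarith
      qed
      ultimately show ?thesis using that by blast
    qed
    then show ?thesis using upper by force
  qed
  then show ?thesis unfolding inj_on_def by (metis lessThan_iff linorder_neqE_nat)
qed

lemma uniform_chain: "uniform s (chain s m j)"
  using finite_card_ed by (auto simp: uniform_def chain_def)

lemma card_chain: "card (chain s m j) = m"
  using ed_inj by (simp add: chain_def card_image)

text \<open>The vertex \<open>v\<close> lies in edge \<open>v div q\<close>. The first edge starts
  at 1 and the last stops before \<open>m * q\<close>; these two missing endpoints are the two
  identifications, and the resulting count \<open>m * q - 1\<close> means excess 1.\<close>

lemma Union_chain: "\<Union>(chain s m j) = {1..m * q - 1}"
proof
  have "v \<in> {1..m * q - 1}" if "i < m" "v \<in> ed i" for i v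
    using ed_cases[OF that(1)]
  proof cases
    case 1
    then show ?thesis using that last_pos q by (auto simp: ed_0)
  next
    case 2
    then have "i * q + q + q \<le> m * q" "q \<le> i * q"
      using link_less[of i "m - 1"] last_pos(1) by auto
    moreover have "i * q \<le> v" "v \<le> i * q + q" using that 2 by (auto simp: ed_mid)
    ultimately show ?thesis using q unfolding atLeastAtMost_iff by linarith
  next
    case 3
    then show ?thesis using that(2) last_pos q unfolding 3 ed_last by auto
  qed
  then show "\<Union>(chain s m j) \<subseteq> {1..m * q - 1}" by (auto simp: chain_def)
  show "{1..m * q - 1} \<subseteq> \<Union>(chain s m j)"
  proof
    fix v assume v: "v \<in> {1..m * q - 1}"
    define i where "i = v div q"
    have vi: "i * q \<le> v" "v < i * q + q"
      using q dividend_less_div_times[of q v] by (auto simp: i_def add.commute)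
    have "i < m"
    proof (rule ccontr)
      assume "\<not> i < m"
      then have "m * q \<le> i * q" by simp
      then show False using vi v q last_pos unfolding atLeastAtMost_iff by linarith
    qed
    have "v \<in> ed i"
      using ed_cases[OF \<open>i < m\<close>]
    proof cases
      case 3
      then show ?thesis using vi last_pos(1) unfolding 3 ed_last by auto
    qed (use vi v in \<open>auto simp: ed_0 ed_mid\<close>)
    then show "v \<in> \<Union>(chain s m j)" using \<open>i < m\<close> by (auto simp: chain_def)
  qed
qed

lemma excess_chain: "excess s (chain s m j) = 1"
proof -
  have "m * q \<ge> 1" using last_pos q by linarith
  then show ?thesis unfolding excess_def card_chain Union_chain by (simp add: s of_nat_diff algebra_simps)
qed

text \<open>Edge 0 shares \<open>q\<close> and \<open>q + 1\<close> with edge 1, a middle edge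
  shares its two link vertices, and the last edge shares its first link vertex and
  \<open>j * q\<close>.\<close>

lemma chain_shared:
  assumes "e \<in> chain s m j"
  shows "card {v \<in> e. \<exists>f\<in>chain s m j. f \<noteq> e \<and> v \<in> f} \<ge> 2"
proof -
  obtain i where i: "i < m" "e = ed i" using assms by (auto simp: chain_def)
  have two: ?thesis if "a \<noteq> b" "a \<in> ed i" "b \<in> ed i" "a \<in> ed i1" "b \<in> ed i2" "i1 < m" "i2 < m" "i1 \<noteq> i" "i2 \<noteq> i"
    for a b i1 i2
  proof -
    have "ed i1 \<noteq> ed i" "ed i2 \<noteq> ed i" using ed_inj that i by (auto simp: inj_on_def)
    then have "{a, b} \<subseteq> {v \<in> e. \<exists>f\<in>chain s m j. f \<noteq> e \<and> v \<in> f}"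
      using that i by (auto simp: chain_def)
    then have "card {a, b} \<le> card {v \<in> e. \<exists>f\<in>chain s m j. f \<noteq> e \<and> v \<in> f}"
      using finite_card_ed[OF i(1)] i(2) by (intro card_mono) auto
    then show ?thesis using that by simp
  qed
  show ?thesis
    using ed_cases[OF i(1)]
  proof cases
    case 1
    have "{q, q + 1} \<subseteq> ed 1" using ed_mid[of 1] j q by auto
    then show ?thesis using 1 j q by (intro two[of q "q + 1" 1 1]) (auto simp: ed_0)
  next
    case 2
    show ?thesis
      using 2 link_in[of i] link_in[of "i + 1"] i q by (intro two[of "i * q" "(i + 1) * q" "i - 1" "i + 1"]) auto
  next
    case 3
    have "j * q \<in> ed j" using link_in(1)[of j] j by auto
    moreover have "j * q \<in> ed i" unfolding 3 ed_last by simp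
    moreover have "j * q \<noteq> (m - 1) * q" using last_pos q by linarith
    ultimately show ?thesis
      using 3 link_in[of i] i q j by (intro two[of "j * q" "(m - 1) * q" j "i - 1"]) auto
  qed
qed

text \<open>Consecutive edges meet, so a subset whose span avoids that of its complement contains
  all edges or none.\<close>

lemma chain_connected:
  assumes "A \<subseteq> chain s m j" "A \<noteq> {}" "A \<noteq> chain s m j"
  shows "\<Union>A \<inter> \<Union>(chain s m j - A) \<noteq> {}"
proof
  assume disj: "\<Union>A \<inter> \<Union>(chain s m j - A) = {}"
  have step: "ed i \<in> A \<longleftrightarrow> ed (i + 1) \<in> A" if "i + 1 < m" for i
  proof -
    have "(i + 1) * q \<in> ed i" "(i + 1) * q \<in> ed (i + 1)"
      using link_in[of "i + 1"] that by auto
    moreover have "ed i \<in> chain s m j" "ed (i + 1) \<in> chain s m j" using that by (auto simp: chain_def)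
    ultimately show ?thesis using disj by blast
  qed
  have "ed i \<in> A \<longleftrightarrow> ed 0 \<in> A" if "i < m" for i
    using that by (induction i) (use step in auto)
  then have "A = chain s m j \<or> A = {}" using assms(1) unfolding chain_def by blast
  then show False using assms by blast
qed

lemma chain_balanced:
  assumes "A \<subseteq> chain s m j" "A \<noteq> {}" "A \<noteq> chain s m j"
  shows "excess s A \<le> 0"
  using excess_proper_subset_less[OF uniform_chain assms(1,3) chain_shared chain_connected[OF assms]]
  by (simp add: excess_chain)

text \<open>In the copy, the walks run along the link vertices from \<open>2 * q\<close> through
  \<open>(l1 + 2) * q\<close> to \<open>j * q\<close>. The cycle vertices \<open>x\<close>,
  \<open>z\<close> of the pattern are the images of the two link vertices of edge
  \<open>j\<close>.\<close>

lemma chain_copy_pattern: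
  assumes inj: "inj_on g (\<Union>(chain s m j))" and sub: "(\<lambda>e. g ` e) ` chain s m j \<subseteq> E"
    and l: "j = l1 + l2 + 2"
  shows "pattern E l1 l2 (m - 1 - j) (g ((l1 + 2) * q))"
proof -
  have inE: "g ` ed i \<in> E" if "i < m" for i using that sub by (auto simp: chain_def)
  have edU: "ed i \<subseteq> \<Union>(chain s m j)" if "i < m" for i using that by (auto simp: chain_def)
  have in_iff: "g a \<in> g ` ed i \<longleftrightarrow> a \<in> ed i" if "i < m" "a \<in> \<Union>(chain s m j)" for a i
    using inj that edU by (meson inj_on_image_mem_iff)
  have linkU: "i * q \<in> \<Union>(chain s m j)" if "1 \<le> i" "i < m" for i
    using link_in(1)[OF that] edU[OF that(2)] by blast
  have g_eq: "g a = g b \<longleftrightarrow> a = b" if "a \<in> \<Union>(chain s m j)" "b \<in> \<Union>(chain s m j)" for a b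
    using inj that by (auto simp: inj_on_def)
  have step: "(g (i * q), g ((i + 1) * q)) \<in> adj E {}" if "1 \<le> i" "i + 1 < m" for i
    using that link_in(1)[of i] link_in(2)[of "i + 1"] inE[of i] linkU[of i] linkU[of "i + 1"] g_eq q
    by (auto simp: adj_def intro!: bexI[of _ "g ` ed i"])
  have walk: "(g (i * q), g ((i + r) * q)) \<in> adj E {} ^^ r" if "1 \<le> i" "i + r < m" for i r
    using that(2)
  proof (induction r)
    case (Suc r)
    then show ?case using step[of "i + r"] that(1) by (auto intro: relcompI)
  qed simp
  let ?A = "{g (j * q), g ((j + 1) * q)}"
  \<comment> \<open>Edges strictly between \<open>j\<close> and the last one lie entirely above
    \<open>j * q\<close>, so they cannot contain the forbidden pair.\<close>
  have back_step: "(g ((i + 1) * q), g (i * q)) \<in> adj E ?A" if "j + 1 \<le> i" "i + 1 < m" for i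
  proof -
    have "j * q \<notin> ed i" using that link_less[of j i] q by (subst ed_mid) auto
    then have "\<not> ?A \<subseteq> g ` ed i" using in_iff[of i "j * q"] linkU[of j] that j by auto
    then show ?thesis
      using that j link_in(1)[of i] link_in(2)[of "i + 1"] inE[of i] linkU[of i] linkU[of "i + 1"] g_eq q
      by (auto simp: adj_def intro!: bexI[of _ "g ` ed i"])
  qed
  have back_walk: "(g ((j + 1 + r) * q), g ((j + 1) * q)) \<in> adj E ?A ^^ r" if "j + 1 + r < m" for r
    using that
  proof (induction r)
    case (Suc r)
    then show ?case using back_step[of "j + 1 + r"] by (intro relpow_Suc_I2) auto
  qed simp
  \<comment> \<open>The last edge does contain \<open>j * q\<close>, but not
    \<open>(j + 1) * q\<close>.\<close>
  have closing: "(g (j * q), g ((m - 1) * q)) \<in> adj E ?A"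
  proof -
    have "(j + 1) * q \<notin> ed (m - 1)" unfolding ed_last using last_pos q by auto
    then have "\<not> ?A \<subseteq> g ` ed (m - 1)" using in_iff[of "m - 1" "(j + 1) * q"] linkU[of "j + 1"] j by auto
    moreover have "j * q \<noteq> (m - 1) * q" using last_pos q by linarith
    then have "g (j * q) \<noteq> g ((m - 1) * q)" using g_eq linkU[of j] linkU[of "m - 1"] j by auto
    moreover have "j * q \<in> ed (m - 1)" unfolding ed_last by simp
    ultimately show ?thesis
      using j link_in(1)[of "m - 1"] inE[of "m - 1"]
      by (auto simp: adj_def intro!: bexI[of _ "g ` ed (m - 1)"])
  qed
  \<comment> \<open>The long way round: one closing step to the last link vertex, then
    \<open>m - 2 - j\<close> steps back down to \<open>(j + 1) * q\<close>.\<close>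
  have cycle: "(g (j * q), g ((j + 1) * q)) \<in> adj E ?A ^^ (m - 1 - j)"
  proof -
    have "(g (j * q), g ((j + 1) * q)) \<in> adj E ?A ^^ Suc (m - 2 - j)"
    proof (rule relpow_Suc_I2[OF closing])
      have "j + 1 + (m - 2 - j) = m - 1" using j by simp
      then show "(g ((m - 1) * q), g ((j + 1) * q)) \<in> adj E ?A ^^ (m - 2 - j)"
        using back_walk[of "m - 2 - j"] j by simp
    qed
    moreover have "Suc (m - 2 - j) = m - 1 - j" using j by simp
    ultimately show ?thesis by (simp only:)
  qed
  \<comment> \<open>Edges 0 and 1 share \<open>q\<close> and \<open>q + 1\<close>; the vertex
    \<open>2 * q\<close> lies only in edge 1 of the two, because \<open>q \<ge> 2\<close>.\<close>
  have ed1: "q \<in> ed 1" "q + 1 \<in> ed 1" "2 * q \<in> ed 1" using ed_mid[of 1] j q by auto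
  have ed0: "q \<in> ed 0" "q + 1 \<in> ed 0" "2 * q \<notin> ed 0" using ed_0 q by auto
  have U: "q \<in> \<Union>(chain s m j)" "q + 1 \<in> \<Union>(chain s m j)" "2 * q \<in> \<Union>(chain s m j)"
    using ed1 edU[of 1] j by auto
  have double: "\<exists>p r. g (2 * q) \<noteq> p \<and> g (2 * q) \<noteq> r \<and> p \<noteq> r \<and>
    (\<exists>e\<in>E. g (2 * q) \<in> e \<and> p \<in> e \<and> r \<in> e) \<and> (\<exists>e\<in>E. p \<in> e \<and> r \<in> e \<and> g (2 * q) \<notin> e)"
  proof (intro exI conjI)
    show "g (2 * q) \<noteq> g q" "g (2 * q) \<noteq> g (q + 1)" "g q \<noteq> g (q + 1)"
      using g_eq U q by auto
    show "\<exists>e\<in>E. g (2 * q) \<in> e \<and> g q \<in> e \<and> g (q + 1) \<in> e"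
      using inE[of 1] ed1 j by (intro bexI[of _ "g ` ed 1"]) auto
    show "\<exists>e\<in>E. g q \<in> e \<and> g (q + 1) \<in> e \<and> g (2 * q) \<notin> e"
      using inE[of 0] ed0 j in_iff[of 0 "2 * q"] U by (intro bexI[of _ "g ` ed 0"]) auto
  qed
  show ?thesis unfolding pattern_def
  proof (intro conjI)
    show "\<exists>x. (x, g ((l1 + 2) * q)) \<in> adj E {} ^^ l1 \<and>
        (\<exists>p q. x \<noteq> p \<and> x \<noteq> q \<and> p \<noteq> q \<and>
          (\<exists>e\<in>E. x \<in> e \<and> p \<in> e \<and> q \<in> e) \<and> (\<exists>e\<in>E. p \<in> e \<and> q \<in> e \<and> x \<notin> e))"
    proof -
      have "(g (2 * q), g ((2 + l1) * q)) \<in> adj E {} ^^ l1" using walk[of 2 l1] l j by simp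
      then show ?thesis using double unfolding add.commute[of l1 2] by blast
    qed
    show "\<exists>x. (g ((l1 + 2) * q), x) \<in> adj E {} ^^ l2 \<and>
        (\<exists>z. (x, z) \<in> adj E {} \<and> (x, z) \<in> adj E {x, z} ^^ (m - 1 - j))"
    proof (intro exI conjI)
      have "l1 + 2 + l2 = j" using l by simp
      then show "(g ((l1 + 2) * q), g (j * q)) \<in> adj E {} ^^ l2"
        using walk[of "l1 + 2" l2] j by simp
      show "(g (j * q), g ((j + 1) * q)) \<in> adj E {}" using step[of j] j by simp
      show "(g (j * q), g ((j + 1) * q)) \<in> adj E ?A ^^ (m - 1 - j)" by (rule cycle)
    qed
  qed
qed

section \<open>Copies of the chain\<close>

definition copies :: "nat \<Rightarrow> nat set set set" where
  "copies n = {(\<lambda>e. g ` e) ` chain s m j | g. inj_on g (\<Union>(chain s m j)) \<and> g ` \<Union>(chain s m j) \<subseteq> {1..n}}"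

lemma copies_subset: "F \<in> copies n \<Longrightarrow> F \<subseteq> possible_edges s n"
proof
  fix e assume "F \<in> copies n" "e \<in> F"
  then obtain g f where g: "inj_on g (\<Union>(chain s m j))" "g ` \<Union>(chain s m j) \<subseteq> {1..n}"
    and f: "f \<in> chain s m j" "e = g ` f" by (auto simp: copies_def)
  have "inj_on g f" using g(1) f(1) by (auto intro: inj_on_subset)
  then have "card e = s" using f uniform_chain by (auto simp: card_image uniform_def)
  then show "e \<in> possible_edges s n" using f g by (auto simp: possible_edges_def)
qed

lemma finite_copies: "finite (copies n)"
  by (rule finite_subset[of _ "Pow (possible_edges s n)"]) (auto dest: copies_subset simp: finite_possible_edges)

lemma copies_props:
  assumes "F \<in> copies n"
  shows "card F = m" and "excess s F = 1" and "A \<subseteq> F \<Longrightarrow> A \<noteq> {} \<Longrightarrow> A \<noteq> F \<Longrightarrow> excess s A \<le> 0"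
proof -
  from assms obtain g where g: "inj_on g (\<Union>(chain s m j))" and F: "F = (\<lambda>e. g ` e) ` chain s m j"
    by (auto simp: copies_def)
  have "inj_on ((`) g) (chain s m j)" using g by (rule inj_on_image)
  then show "card F = m" unfolding F by (simp add: card_image card_chain)
  show "excess s F = 1" unfolding F by (simp add: excess_image[OF g] excess_chain)
  assume A: "A \<subseteq> F" "A \<noteq> {}" "A \<noteq> F"
  then obtain A0 where A0: "A0 \<subseteq> chain s m j" "A = (\<lambda>e. g ` e) ` A0" unfolding F by (meson subset_image_iff)
  have "inj_on g (\<Union>A0)" using g A0 by (meson Union_mono inj_on_subset)
  then have "excess s A = excess s A0" unfolding A0 by (rule excess_image)
  then show "excess s A \<le> 0" using chain_balanced[of A0] A A0 F by auto
qed

text \<open>Every vertex set of the right size carries at least one copy, and copies on different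
  vertex sets differ.\<close>

lemma card_copies_ge: "n choose (m * q - 1) \<le> card (copies n)"
proof -
  let ?W = "{W. W \<subseteq> {1..n} \<and> card W = m * q - 1}"
  have "?W \<subseteq> Union ` copies n"
  proof
    fix W assume "W \<in> ?W"
    then have W: "W \<subseteq> {1..n}" "card W = card {1..m * q - 1}" by auto
    have "finite W" using W finite_subset by blast
    then obtain g where g: "bij_betw g {1..m * q - 1} W"
      using W(2) by (metis finite_same_card_bij finite_atLeastAtMost)
    then have im: "g ` \<Union>(chain s m j) = W" and inj: "inj_on g (\<Union>(chain s m j))"
      unfolding Union_chain by (auto simp: bij_betw_def)
    have "(\<lambda>e. g ` e) ` chain s m j \<in> copies n" using im inj W unfolding copies_def by blast
    moreover have "\<Union>((\<lambda>e. g ` e) ` chain s m j) = W" using im by auto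
    ultimately show "W \<in> Union ` copies n" by blast
  qed
  then have "card ?W \<le> card (copies n)" by (rule surj_card_le[OF finite_copies])
  then show ?thesis by (simp add: n_subsets)
qed

text \<open>Both copies have \<open>m\<close> edges, so their intersection is a proper nonempty part
  with excess at most 0. Supermodularity then gives the union excess at least 1 + 1 - 0.\<close>

lemma copies_overlap:
  assumes "F \<in> copies n" "F' \<in> copies n" "F \<noteq> F'" "F \<inter> F' \<noteq> {}"
  shows "F \<union> F' \<in> dense_sets s n 2 (2 * m)"
proof -
  have u: "uniform s F" "uniform s F'"
    using assms copies_subset uniform_possible_edges by blast+
  have "F \<inter> F' \<noteq> F"
  proof
    assume "F \<inter> F' = F"
    then have "F \<subseteq> F'" by blast
    then show False using assms copies_props(1) u by (metis card_subset_eq uniform_finite)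
  qed
  then have "excess s (F \<inter> F') \<le> 0" using copies_props(3)[OF assms(1), of "F \<inter> F'"] assms(4) by blast
  then have "excess s (F \<union> F') \<ge> 2"
    using excess_Un_ge[OF u] copies_props(2) assms by fastforce
  moreover have "card (F \<union> F') \<le> 2 * m"
    using card_Un_le[of F F'] copies_props(1) assms by fastforce
  ultimately show ?thesis
    unfolding dense_sets_def using assms(4) copies_subset[OF assms(1)] copies_subset[OF assms(2)] by auto
qed

end

section \<open>Failure of the zero-one law\<close>

text \<open>The factor \<open>x / (x + x^2 + K)\<close> is the optimal \<open>r\<close> when
  \<open>D\<close> equals its upper bound. The optimum \<open>x^2 / (x + x^2 + K)\<close> increases
  with \<open>x\<close>, so \<open>x\<close> may be replaced by its lower bound
  \<open>c\<close>.\<close>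

lemma second_moment_ratio:
  fixes c x D K :: real
  assumes "0 < c" "c \<le> x" "0 \<le> K" "D \<le> x + x\<^sup>2 + K"
  shows "c\<^sup>2 / (c + c\<^sup>2 + K) \<le> 2 * (x / (x + x\<^sup>2 + K)) * x - (x / (x + x\<^sup>2 + K))\<^sup>2 * D"
proof -
  let ?M = "x + x\<^sup>2 + K"
  have x: "x > 0" and M: "?M > 0" and N: "c + c\<^sup>2 + K > 0"
    using assms by (simp_all add: add_pos_nonneg)
  have "c\<^sup>2 * x \<le> x\<^sup>2 * c"
    using assms x mult_left_mono[of c x "c * x"] by (simp add: power2_eq_square algebra_simps)
  moreover have "c\<^sup>2 * K \<le> x\<^sup>2 * K" using assms by (intro mult_right_mono power_mono) auto
  ultimately have "c\<^sup>2 * ?M \<le> x\<^sup>2 * (c + c\<^sup>2 + K)" by (simp add: algebra_simps)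
  then have "c\<^sup>2 / (c + c\<^sup>2 + K) \<le> x\<^sup>2 / ?M" using M N by (simp add: divide_simps mult.commute)
  also have "\<dots> = 2 * (x / ?M) * x - (x / ?M)\<^sup>2 * ?M"
  proof -
    have "x\<^sup>2 / y = 2 * (x / y) * x - (x / y)\<^sup>2 * y" if "y > 0" for y
      using that by (simp add: power2_eq_square)
    then show ?thesis using M by blast
  qed
  also have "\<dots> \<le> 2 * (x / ?M) * x - (x / ?M)\<^sup>2 * D"
    using assms(4) by (intro diff_left_mono mult_left_mono) auto
  finally show ?thesis .
qed

text \<open>A copy has \<open>v\<close> vertices and \<open>\<alpha> * m = v\<close>, so its
  probability is \<open>1 / n ^ v\<close>. With at least \<open>(n / v) ^ v\<close> copies the mean
  is at least \<open>c\<close>, uniformly in \<open>n\<close>, and \<open>K\<close> bounds the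
  contribution of overlapping pairs.\<close>

lemma (in chain_graph) prob_chain_copy_ge:
  assumes \<alpha>: "\<alpha> = real s - 1 - 1 / real m" and n: "n \<ge> m * q - 1" and "\<alpha> \<ge> 0"
  defines "v \<equiv> m * q - 1"
  defines "c \<equiv> (1 / real v) ^ v" and "K \<equiv> 4 ^ (2 * m) * (\<Sum>f\<le>2 * m. 2 ^ 2 ^ ((s - 1) * f))"
  shows "expect (real n powr - \<alpha>) (possible_edges s n) (\<lambda>S. of_bool (\<exists>F\<in>copies n. F \<subseteq> S))
    \<ge> c\<^sup>2 / (c + c\<^sup>2 + K)"
proof -
  define p where "p = real n powr - \<alpha>"
  have mq: "v \<ge> 1" "m \<ge> 1" "s \<ge> 1" using last_pos q j by (auto simp: v_def s)
  have n1: "n \<ge> 1" using mq n by (simp add: v_def)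
  have p: "0 < p" "p \<le> 1"
    using n1 \<open>\<alpha> \<ge> 0\<close> powr_mono[of "- \<alpha>" 0 "real n"] by (auto simp: p_def)
  define \<mu> where "\<mu> = (\<Sum>F\<in>copies n. p ^ card F)"
  define D where "D = (\<Sum>F\<in>copies n. \<Sum>F'\<in>copies n. p ^ card (F \<union> F'))"
  have \<mu>: "\<mu> = real (card (copies n)) * p ^ m"
    by (simp add: \<mu>_def copies_props(1))
  have pm: "p ^ m = 1 / real n ^ v"
  proof -
    have "p ^ m = real n powr (- \<alpha> * real m)"
      using n1 by (simp add: p_def powr_realpow[symmetric] powr_powr)
    also have "- \<alpha> * real m = - real v"
    proof -
      have "real v = real m * real q - 1" proof -
        have "v + 1 = m * q" using mq(1) by (simp add: v_def)
        then have "real (v + 1) = real (m * q)" by (rule arg_cong)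
        then show ?thesis by simp
      qed
      moreover have "\<alpha> * real m = real m * real q - 1" using mq by (simp add: \<alpha> s left_diff_distrib)
      ultimately show ?thesis by simp
    qed
    finally show ?thesis using n1 by (simp add: powr_minus powr_realpow divide_simps)
  qed
  have "(real n / real v) ^ v \<le> real (n choose v)"
    using n by (intro binomial_ge_n_over_k_pow_k) (simp add: v_def)
  also have "\<dots> \<le> real (card (copies n))" using card_copies_ge by (simp add: v_def)
  finally have "(real n / real v) ^ v * p ^ m \<le> \<mu>"
    unfolding \<mu> using p by (intro mult_right_mono) auto
  moreover have "(real n / real v) ^ v * p ^ m = c"
    using n1 by (simp add: pm c_def power_divide)
  ultimately have c: "c \<le> \<mu>" "c > 0" using mq by (auto simp: c_def)
  have "D \<le> \<mu> + \<mu>\<^sup>2 + (\<Sum>U\<in>dense_sets s n 2 (2 * m). 4 ^ card U * p ^ card U)"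
    unfolding D_def \<mu>_def
  proof (rule sum_pairs_le)
    show "finite F" if "F \<in> copies n" for F
      using copies_subset[OF that] finite_possible_edges by (rule finite_subset)
    show "finite U" if "U \<in> dense_sets s n 2 (2 * m)" for U
      using that finite_possible_edges by (auto simp: dense_sets_def intro: finite_subset)
  qed (use p finite_copies finite_dense_sets copies_overlap in auto)
  also have "(\<Sum>U\<in>dense_sets s n 2 (2 * m). 4 ^ card U * p ^ card U) \<le>
    (\<Sum>U\<in>dense_sets s n 2 (2 * m). 4 ^ (2 * m) * p ^ card U)"
    using p by (intro sum_mono mult_right_mono power_increasing) (auto simp: dense_sets_def)
  also have "\<dots> = 4 ^ (2 * m) * (\<Sum>U\<in>dense_sets s n 2 (2 * m). p ^ card U)"
    by (simp add: sum_distrib_left)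
  also have "\<dots> \<le> K"
    unfolding K_def p_def using sum_dense_sets_bounded[OF mq(3,2) n1 \<alpha>, of 2] by (intro mult_left_mono) auto
  finally have "D \<le> \<mu> + \<mu>\<^sup>2 + K" by simp
  moreover have "K \<ge> 0" by (auto simp: K_def intro!: mult_nonneg_nonneg sum_nonneg)
  ultimately have "c\<^sup>2 / (c + c\<^sup>2 + K) \<le> 2 * (\<mu> / (\<mu> + \<mu>\<^sup>2 + K)) * \<mu> - (\<mu> / (\<mu> + \<mu>\<^sup>2 + K))\<^sup>2 * D"
    using c by (intro second_moment_ratio)
  also have "\<dots> \<le> expect p (possible_edges s n) (\<lambda>S. of_bool (\<exists>F\<in>copies n. F \<subseteq> S))"
    unfolding D_def \<mu>_def
    using p finite_copies copies_subset finite_possible_edges by (intro expect_second_moment) auto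
  finally show ?thesis unfolding p_def .
qed

lemma prob_no_dense_set_ge:
  assumes "s \<ge> 1" "m \<ge> 1" "n \<ge> 1" and \<alpha>: "\<alpha> = real s - 1 - 1 / real m" and p: "real n powr - \<alpha> \<le> 1 / 2"
  shows "expect (real n powr - \<alpha>) (possible_edges s n) (\<lambda>S. of_bool (\<forall>F\<in>dense_sets s n 1 m. \<not> F \<subseteq> S))
    \<ge> exp (- 2 * (\<Sum>f\<le>m. 2 ^ 2 ^ ((s - 1) * f)))"
  using sum_dense_sets_bounded[OF assms(1-3) \<alpha>, of 1] p
  by (intro expect_avoid_ge_exp finite_possible_edges finite_dense_sets) (auto simp: dense_sets_def)

theorem theorem9:
  fixes s k a :: nat and \<alpha> :: real
  assumes "s \<ge> 3" and "k \<ge> s + 4"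
    and "a \<ge> 1" and "a \<le> 2 ^ (k - s - 2) + 2 ^ (k - s - 3) + 1"
    and "\<alpha> = real s - 1 - 1 / (2 ^ (k - s + 1) + real a)"
  shows "\<not> obeys_zero_one_law s (\<lambda>n. real n powr (- \<alpha>)) k"
proof
  assume law: "obeys_zero_one_law s (\<lambda>n. real n powr (- \<alpha>)) k"
  \<comment> \<open>The depth \<open>k = s + t\<close> allows walks of length \<open>2 ^ t\<close>.
    The double edge, two arms of \<open>l\<close> edges and a cycle of \<open>a + 2\<close> edges
    make \<open>2 + 2 * l + a + 2 = m\<close> edges, and the cycle starts at edge
    \<open>j\<close>.\<close>
  define t where "t = k - s"
  define l where "l = (2 :: nat) ^ t - 2"
  define m where "m = 2 ^ (t + 1) + a"
  define j where "j = l + l + 2"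
  define \<phi> where "\<phi> = pattern_fm s t l l (a + 1)"
  have t: "t \<ge> 4" "k = s + t" using assms by (auto simp: t_def)
  \<comment> \<open>All powers of two involved become multiples of \<open>u\<close>, which reduces
    the size conditions to linear arithmetic.\<close>
  define u where "u = (2 :: nat) ^ (t - 4)"
  have u: "u \<ge> 1" "2 ^ t = 16 * u" "2 ^ (t - 1) = 8 * u" "2 ^ (k - s - 2) = 4 * u" "2 ^ (k - s - 3) = 2 * u"
  proof -
    obtain r where r: "t = r + 4" using t(1) by (metis add.commute le_Suc_ex)
    have "k - s - 2 = r + 2" "k - s - 3 = r + 1" using r by (auto simp: t_def)
    then show "u \<ge> 1" "2 ^ t = 16 * u" "2 ^ (t - 1) = 8 * u" "2 ^ (k - s - 2) = 4 * u" "2 ^ (k - s - 3) = 2 * u"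
      by (auto simp: u_def r power_add)
  qed
  have a: "a \<le> 6 * u + 1" using assms(4) u by simp
  have m: "m = 32 * u + a" and l: "l = 16 * u - 2" using u by (auto simp: m_def l_def)
  interpret chain_graph s m j "s - 1"
    using assms(1,3) u(1) by unfold_locales (auto simp: j_def m l)
  have c: "m - 1 - j = a + 1" and total: "l + l + (a + 1) + 3 = m"
    using u(1) by (auto simp: j_def m l)
  have bounds: "l \<le> 2 ^ t" "a + 1 \<le> 2 ^ (t - 1)" using u a by (auto simp: l)
  have \<alpha>: "\<alpha> = real s - 1 - 1 / real m" unfolding assms(5) by (simp add: m_def t_def)
  have "1 / real m \<le> 1" using u(1) m by (simp add: divide_le_eq)
  then have "\<alpha> \<ge> 1" using assms(1) \<alpha> by linarith
  define P where "P n = measure_pmf.prob (random_hypergraph s n (real n powr - \<alpha>)) {E. models {1..n} E \<phi>}" for n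
  have P: "P n = expect (real n powr - \<alpha>) (possible_edges s n) (\<lambda>S. of_bool (\<exists>y\<in>{1..n}. pattern S l l (a + 1) y))"
    if "n \<ge> 1" for n
  proof -
    have "real n powr - \<alpha> \<le> 1" using that \<open>\<alpha> \<ge> 1\<close> powr_mono[of "- \<alpha>" 0 "real n"] by simp
    then have "P n = expect (real n powr - \<alpha>) (possible_edges s n) (\<lambda>S. of_bool (S \<in> {E. models {1..n} E \<phi>}))"
      unfolding P_def by (intro prob_random_hypergraph) auto
    also have "\<dots> = expect (real n powr - \<alpha>) (possible_edges s n) (\<lambda>S. of_bool (\<exists>y\<in>{1..n}. pattern S l l (a + 1) y))"
      unfolding \<phi>_def mem_Collect_eq
      by (intro expect_cong arg_cong[where f = of_bool] models_pattern_fm assms(1) that bounds)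
    finally show ?thesis .
  qed
  have "of_arity s \<phi>" "free_vars \<phi> = {}" "quantifier_depth \<phi> \<le> k"
    unfolding \<phi>_def using pattern_fm_syntax[of s t] assms(1) t by auto
  then have lim: "P \<longlonglongrightarrow> 0 \<or> P \<longlonglongrightarrow> 1"
    using law unfolding obeys_zero_one_law_def Let_def P_def by blast
  have powr_small: "real n powr - \<alpha> \<le> 1 / 2" if "n \<ge> 2" for n
  proof -
    have "real n powr - \<alpha> \<le> real n powr - 1" using that \<open>\<alpha> \<ge> 1\<close> by (intro powr_mono) auto
    also have "\<dots> = 1 / real n" using that by (simp add: powr_minus_divide)
    also have "\<dots> \<le> 1 / 2" using that by (simp add: divide_simps)
    finally show ?thesis .
  qed
  \<comment> \<open>The sentence holds whenever a copy of the chain is present, so its probability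
    does not tend to 0.\<close>
  obtain d where d: "d > 0" "\<And>n. n \<ge> m * (s - 1) - 1 \<Longrightarrow> d \<le> P n"
  proof -
    define v where "v = m * (s - 1) - 1"
    define c where "c = (1 / real v) ^ v"
    define K :: real where "K = 4 ^ (2 * m) * (\<Sum>f\<le>2 * m. 2 ^ 2 ^ ((s - 1) * f))"
    have "v \<ge> 1" unfolding v_def using last_pos(2,3) q by linarith
    then have "c > 0" by (simp add: c_def)
    moreover have "K \<ge> 0" by (auto simp: K_def intro!: mult_nonneg_nonneg sum_nonneg)
    ultimately have "c\<^sup>2 / (c + c\<^sup>2 + K) > 0" by (intro divide_pos_pos add_pos_nonneg) auto
    moreover have "c\<^sup>2 / (c + c\<^sup>2 + K) \<le> P n" if n: "n \<ge> v" for n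
    proof -
      have "n \<ge> 1" using n \<open>v \<ge> 1\<close> by linarith
      have "c\<^sup>2 / (c + c\<^sup>2 + K) \<le>
        expect (real n powr - \<alpha>) (possible_edges s n) (\<lambda>S. of_bool (\<exists>F\<in>copies n. F \<subseteq> S))"
        unfolding c_def K_def v_def
        using n \<open>\<alpha> \<ge> 1\<close> by (intro prob_chain_copy_ge \<alpha>) (auto simp: v_def)
      also have "\<dots> \<le> P n" unfolding P[OF \<open>n \<ge> 1\<close>]
      proof (intro expect_mono)
        show "real n powr - \<alpha> \<le> 1" using \<open>n \<ge> 1\<close> \<open>\<alpha> \<ge> 1\<close> powr_mono[of "- \<alpha>" 0 "real n"] by simp
        fix S
        show "of_bool (\<exists>F\<in>copies n. F \<subseteq> S) \<le> (of_bool (\<exists>y\<in>{1..n}. pattern S l l (a + 1) y) :: real)"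
        proof (cases "\<exists>F\<in>copies n. F \<subseteq> S")
          case True
          then obtain g where g: "inj_on g (\<Union>(chain s m j))" "g ` \<Union>(chain s m j) \<subseteq> {1..n}"
            "(\<lambda>e. g ` e) ` chain s m j \<subseteq> S" by (auto simp: copies_def)
          have pat: "pattern S l l (a + 1) (g ((l + 2) * (s - 1)))"
            using chain_copy_pattern[OF g(1,3) j_def] unfolding c .
          have "(l + 2) * (s - 1) \<in> chain_edge s m j (l + 2)"
            using u(1) by (intro link_in(1)) (auto simp: m l)
          moreover have "chain_edge s m j (l + 2) \<in> chain s m j"
            using u(1) by (auto simp: chain_def m l)
          ultimately have "g ((l + 2) * (s - 1)) \<in> {1..n}" using g(2) by blast
          then show ?thesis using pat by auto
        qed simp
      qed simp
      finally show ?thesis .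
    qed
    ultimately show ?thesis using that unfolding v_def by blast
  qed
  \<comment> \<open>The sentence fails when no set of at most \<open>m\<close> edges has positive
    excess, so its probability does not tend to 1.\<close>
  obtain d' where d': "d' > 0" "\<And>n. n \<ge> 2 \<Longrightarrow> P n \<le> 1 - d'"
  proof -
    define d' :: real where "d' = exp (- 2 * (\<Sum>f\<le>m. 2 ^ 2 ^ ((s - 1) * f)))"
    have "P n \<le> 1 - d'" if n: "n \<ge> 2" for n
    proof -
      let ?p = "real n powr - \<alpha>" and ?I = "possible_edges s n"
      have "P n \<le> expect ?p ?I (\<lambda>S. 1 - of_bool (\<forall>F\<in>dense_sets s n 1 m. \<not> F \<subseteq> S))"
        unfolding P[OF order_trans[OF one_le_numeral n]]
      proof (intro expect_mono)
        show "?p \<le> 1" using powr_small[OF n] by simp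
        fix S assume S: "S \<subseteq> ?I"
        show "of_bool (\<exists>y\<in>{1..n}. pattern S l l (a + 1) y)
          \<le> (1 - of_bool (\<forall>F\<in>dense_sets s n 1 m. \<not> F \<subseteq> S) :: real)"
        proof (cases "\<exists>y\<in>{1..n}. pattern S l l (a + 1) y")
          case True
          then obtain F where "F \<subseteq> S" "F \<noteq> {}" "card F \<le> m" "excess s F \<ge> 1"
            using pattern_excess[OF _ uniform_possible_edges[OF S]] total by metis
          then have "F \<in> dense_sets s n 1 m" "F \<subseteq> S" using S by (auto simp: dense_sets_def)
          then show ?thesis by auto
        qed simp
      qed simp
      also have "\<dots> = 1 - expect ?p ?I (\<lambda>S. of_bool (\<forall>F\<in>dense_sets s n 1 m. \<not> F \<subseteq> S))"
        by (simp only: expect_linear expect_one[OF finite_possible_edges])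
      also have "\<dots> \<le> 1 - d'"
        unfolding d'_def using assms(1) u(1) m n
        by (intro diff_left_mono prob_no_dense_set_ge \<alpha> powr_small) auto
      finally show ?thesis .
    qed
    then show ?thesis using that[of d'] by (simp add: d'_def)
  qed
  from lim show False
  proof
    assume "P \<longlonglongrightarrow> 0"
    moreover have "\<exists>N. \<forall>n\<ge>N. d \<le> P n" using d(2) by blast
    ultimately have "d \<le> 0" by (rule LIMSEQ_le_const)
    then show False using d(1) by simp
  next
    assume "P \<longlonglongrightarrow> 1"
    moreover have "\<exists>N. \<forall>n\<ge>N. P n \<le> 1 - d'" using d'(2) by blast
    ultimately have "1 \<le> 1 - d'" by (rule LIMSEQ_le_const2)
    then show False using d'(1) by simp
  qed
qed

end
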